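(* Let $(\star)$ be a linear system over $\mathbb{F}_q$ with coefficient matrix $A\in\mathbb{F}_q^{m\times k}$ which is of type (RC), non-degenerate and irreducible, and let $\ell$ be its number of column equivalence classes. Suppose that at least one of the following holds: (i) none of the column equivalence classes of size $2$ sums to zero; (ii) every column equivalence class sums to zero, and $k\ge 3$. Then $(\star)$ is moderate.
   Context: Let $\mathbb{F}_q$ be a finite field with $q$ elements. A linear system $(\star)$ with coefficient matrix $A=(a_{ij})\in\mathbb{F}_q^{m\times k}$ is the system of equations $a_{i1}x_1+\cdots+a_{ik}x_k=0$ ($i\in[m]$); a solution is a $k$-tuple $(x_1,\dots,x_k)\in(\mathbb{F}_q^n)^k$ satisfying all of them. The system is balanced if every row of $A$ sums to $0$. A $(\star)$-shape is a solution with $x_1,\dots,x_k$ pairwise distinct. The system is moderate if there exist constants $\beta,\gamma>0$ with $\gamma<q$ such that for every $n$, every subset $S\subseteq\mathbb{F}_q^n$ with $|S|\ge\beta\gamma^n$ contains a $(\star)$-shape, i.e. one with $(x_1,\dots,x_k)\in S^k$. Two indices $j,j'\in[k]$ are equivalent if the $j$-th and $j'$-th columns of $A$ are nonzero scalar multiples of one another; the equivalence classes are the column equivalence classes. A column equivalence class sums to zero if the columns of $A$ indexed by it add up to the zero vector. The system is of type (RC) if it is balanced and has at most one column equivalence class of size $1$. It is non-degenerate if the rows of $A$ are linearly independent and every variable is used (no column of $A$ is zero). Two systems are equivalent if each equation of one is a linear combination of the equations of the other. A system is reducible if it is equivalent to a system whose variables $x_1,\dots,x_k$ can be partitioned into two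 or more classes such that every equation only uses (has nonzero coefficients on) variables from one class; otherwise it is irreducible. *)

theory Defs
  imports Complex_Main "HOL-Library.Disjoint_Sets"
begin

text \<open>Conventions. The field F_q is a finite field type 'a, q = CARD('a).
A coefficient matrix A in F_q^(m x k) is a function A :: nat => nat => 'a,
with row indices i < m and column indices j < k (0-based).
The space F_q^n is represented by functions x :: nat => 'a vanishing outside {0..<n}.
A k-tuple of vectors is a function xs :: nat => (nat => 'a), indices j < k.\<close>

definition vecs :: "nat \<Rightarrow> (nat \<Rightarrow> 'a::zero) set" where
  "vecs n = {x. \<forall>t\<ge>n. x t = 0}"

definition is_solution :: "nat \<Rightarrow> nat \<Rightarrow> (nat \<Rightarrow> nat \<Rightarrow> 'a::field) \<Rightarrow> nat \<Rightarrow> (nat \<Rightarrow> nat \<Rightarrow> 'a) \<Rightarrow> bool" where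
  "is_solution m k A n xs \<longleftrightarrow>
     (\<forall>j<k. xs j \<in> vecs n) \<and> (\<forall>i<m. \<forall>t. (\<Sum>j<k. A i j * xs j t) = 0)"

definition is_shape :: "nat \<Rightarrow> nat \<Rightarrow> (nat \<Rightarrow> nat \<Rightarrow> 'a::field) \<Rightarrow> nat \<Rightarrow> (nat \<Rightarrow> nat \<Rightarrow> 'a) \<Rightarrow> bool" where
  "is_shape m k A n xs \<longleftrightarrow> is_solution m k A n xs \<and> (\<forall>j<k. \<forall>j'<k. j \<noteq> j' \<longrightarrow> xs j \<noteq> xs j')"

definition moderate :: "nat \<Rightarrow> nat \<Rightarrow> (nat \<Rightarrow> nat \<Rightarrow> 'a::{field,finite}) \<Rightarrow> bool" where
  "moderate m k A \<longleftrightarrow>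
     (\<exists>\<beta> \<gamma> :: real. \<beta> > 0 \<and> \<gamma> > 0 \<and> \<gamma> < real (card (UNIV :: 'a set)) \<and>
        (\<forall>n. \<forall>S \<subseteq> vecs n. real (card S) \<ge> \<beta> * \<gamma> ^ n \<longrightarrow>
            (\<exists>xs. is_shape m k A n xs \<and> (\<forall>j<k. xs j \<in> S))))"

definition balanced :: "nat \<Rightarrow> nat \<Rightarrow> (nat \<Rightarrow> nat \<Rightarrow> 'a::field) \<Rightarrow> bool" where
  "balanced m k A \<longleftrightarrow> (\<forall>i<m. (\<Sum>j<k. A i j) = 0)"

definition col_equiv :: "nat \<Rightarrow> (nat \<Rightarrow> nat \<Rightarrow> 'a::field) \<Rightarrow> nat \<Rightarrow> nat \<Rightarrow> bool" where
  "col_equiv m A j j' \<longleftrightarrow> (\<exists>c. c \<noteq> 0 \<and> (\<forall>i<m. A i j' = c * A i j))"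

definition col_classes :: "nat \<Rightarrow> nat \<Rightarrow> (nat \<Rightarrow> nat \<Rightarrow> 'a::field) \<Rightarrow> nat set set" where
  "col_classes m k A = (\<lambda>j. {j'. j' < k \<and> col_equiv m A j j'}) ` {..<k}"

definition class_sums_zero :: "nat \<Rightarrow> (nat \<Rightarrow> nat \<Rightarrow> 'a::field) \<Rightarrow> nat set \<Rightarrow> bool" where
  "class_sums_zero m A C \<longleftrightarrow> (\<forall>i<m. (\<Sum>j\<in>C. A i j) = 0)"

definition type_RC :: "nat \<Rightarrow> nat \<Rightarrow> (nat \<Rightarrow> nat \<Rightarrow> 'a::field) \<Rightarrow> bool" where
  "type_RC m k A \<longleftrightarrow> balanced m k A \<and> card {C \<in> col_classes m k A. card C = 1} \<le> 1"

definition non_degenerate :: "nat \<Rightarrow> nat \<Rightarrow> (nat \<Rightarrow> nat \<Rightarrow> 'a::field) \<Rightarrow> bool" where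
  "non_degenerate m k A \<longleftrightarrow>
     (\<forall>c :: nat \<Rightarrow> 'a. (\<forall>j<k. (\<Sum>i<m. c i * A i j) = 0) \<longrightarrow> (\<forall>i<m. c i = 0)) \<and>
     (\<forall>j<k. \<exists>i<m. A i j \<noteq> 0)"

definition rows_combination :: "nat \<Rightarrow> nat \<Rightarrow> (nat \<Rightarrow> nat \<Rightarrow> 'a::field) \<Rightarrow> nat \<Rightarrow> (nat \<Rightarrow> nat \<Rightarrow> 'a) \<Rightarrow> bool" where
  "rows_combination k m A m' B \<longleftrightarrow>
     (\<forall>i'<m'. \<exists>c :: nat \<Rightarrow> 'a. \<forall>j<k. B i' j = (\<Sum>i<m. c i * A i j))"

definition systems_equiv :: "nat \<Rightarrow> nat \<Rightarrow> (nat \<Rightarrow> nat \<Rightarrow> 'a::field) \<Rightarrow> nat \<Rightarrow> (nat \<Rightarrow> nat \<Rightarrow> 'a) \<Rightarrow> bool" where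
  "systems_equiv k m A m' B \<longleftrightarrow> rows_combination k m A m' B \<and> rows_combination k m' B m A"

definition reducible :: "nat \<Rightarrow> nat \<Rightarrow> (nat \<Rightarrow> nat \<Rightarrow> 'a::field) \<Rightarrow> bool" where
  "reducible m k A \<longleftrightarrow>
     (\<exists>m' B P. systems_equiv k m A m' B \<and> partition_on {..<k} P \<and> card P \<ge> 2 \<and>
        (\<forall>i<m'. \<exists>C\<in>P. \<forall>j<k. B i j \<noteq> 0 \<longrightarrow> j \<in> C))"

definition irreducible_sys :: "nat \<Rightarrow> nat \<Rightarrow> (nat \<Rightarrow> nat \<Rightarrow> 'a::field) \<Rightarrow> bool" where
  "irreducible_sys m k A \<longleftrightarrow> \<not> reducible m k A"

end

theory Submission
  imports Defs "HOL-Library.FuncSet"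
begin

text \<open>
  For a balanced equation in three variables, a solution in which two variables coincide is constant,
  so the slice rank method applies; this is the only step that is not elementary.
  Call a point \<open>x\<close> robust for a family of coefficients if its multiple by the sum of the coefficients
  is a combination, with these coefficients, of distinct points of \<open>S\<close> outside any prescribed small
  set. If the corresponding equation is moderate, all but a small fraction of \<open>S\<close> is robust:
  otherwise, choosing pairwise non-blocking points, one finds a large subset without solutions.
  Hence variables may be merged and later split up again, which reduces a balanced equation in at
  least three variables to three variables or to two differences.

  In case (i), take a point \<open>x\<close> that is robust for every column class and replace the summand of each
  class in the constant solution \<open>x\<close>. In case (ii), every class contributes a difference of two robust
  points, and the differences must solve a homogeneous system. Irreducibility says that no class lies
  outside the span of the others, so fixing one coordinate divides the size of the solution space by
  the size of \<open>vecs n\<close>; by the pigeonhole principle some coset of the solution space contains two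
  tuples from \<open>S\<close> that differ in every coordinate.
\<close>


section \<open>Unavoidable properties\<close>

text \<open>The quantifiers of \<open>moderate\<close> with an arbitrary property in place of the
  existence of a shape. Such properties are closed under finite conjunctions and under passing to
  subsets of constant density, so later arguments need not track \<beta> and \<gamma>.\<close>

definition unavoidable :: "(nat \<Rightarrow> (nat \<Rightarrow> 'a::{field,finite}) set \<Rightarrow> bool) \<Rightarrow> bool" where
  "unavoidable P \<longleftrightarrow>
     (\<exists>\<beta> \<gamma> :: real. \<beta> > 0 \<and> \<gamma> > 0 \<and> \<gamma> < real (card (UNIV :: 'a set)) \<and>
        (\<forall>n. \<forall>S \<subseteq> vecs n. real (card S) \<ge> \<beta> * \<gamma> ^ n \<longrightarrow> P n S))"

lemma bij_betw_vecs:
  "bij_betw (\<lambda>x. restrict x {..<n}) (vecs n :: (nat \<Rightarrow> 'a::zero) set) (PiE {..<n} (\<lambda>_. UNIV))"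
proof (rule bij_betwI[where g = "\<lambda>x t. if t < n then x t else 0"])
  show "(\<lambda>x. restrict x {..<n}) \<in> vecs n \<rightarrow> (PiE {..<n} (\<lambda>_. UNIV :: 'a set))" by auto
  show "(\<lambda>x t. if t < n then x t else 0) \<in> (PiE {..<n} (\<lambda>_. UNIV :: 'a set)) \<rightarrow> vecs n"
    by (auto simp: vecs_def)
qed (auto simp: vecs_def fun_eq_iff PiE_def extensional_def)

lemma finite_vecs [simp]: "finite (vecs n :: (nat \<Rightarrow> 'a::{zero,finite}) set)"
  using bij_betw_finite[OF bij_betw_vecs] by (metis finite_PiE finite finite_lessThan)

lemma card_vecs: "card (vecs n :: (nat \<Rightarrow> 'a::{zero,finite}) set) = card (UNIV :: 'a set) ^ n"
proof -
  have "bij_betw (\<lambda>x. restrict x {..<n}) (vecs n :: (nat \<Rightarrow> 'a) set) (PiE {..<n} (\<lambda>_. UNIV))"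
    by (rule bij_betw_vecs)
  from bij_betw_same_card[OF this] show ?thesis by (simp add: card_PiE)
qed

lemma finite_subset_vecs: "S \<subseteq> vecs n \<Longrightarrow> finite (S :: (nat \<Rightarrow> 'a::{zero,finite}) set)"
  using finite_vecs finite_subset by blast

lemma card_field_ge_2: "card (UNIV :: 'a::{field,finite} set) \<ge> 2"
proof -
  have "card {0, 1 :: 'a} \<le> card (UNIV :: 'a set)" by (rule card_mono) auto
  then show ?thesis by simp
qed

lemma unavoidable_mono:
  assumes "unavoidable P" "\<And>n S. S \<subseteq> vecs n \<Longrightarrow> P n S \<Longrightarrow> Q n S"
  shows "unavoidable Q"
proof -
  obtain \<beta> \<gamma> :: real where b: "\<beta> > 0" "\<gamma> > 0" "\<gamma> < real (card (UNIV :: 'a set))"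
    "\<forall>n. \<forall>S \<subseteq> vecs n. real (card S) \<ge> \<beta> * \<gamma> ^ n \<longrightarrow> P n S"
    using assms(1) unfolding unavoidable_def by blast
  show ?thesis unfolding unavoidable_def
    by (rule exI[of _ \<beta>], rule exI[of _ \<gamma>]) (use b assms(2) in blast)
qed

lemma unavoidable_conj:
  fixes P Q :: "nat \<Rightarrow> (nat \<Rightarrow> 'a::{field,finite}) set \<Rightarrow> bool"
  assumes "unavoidable P" "unavoidable Q"
  shows "unavoidable (\<lambda>n S. P n S \<and> Q n S)"
proof -
  let ?q = "real (card (UNIV :: 'a set))"
  obtain \<beta> \<gamma> :: real where b: "\<beta> > 0" "\<gamma> > 0" "\<gamma> < ?q"
    "\<forall>n. \<forall>S \<subseteq> vecs n. real (card S) \<ge> \<beta> * \<gamma> ^ n \<longrightarrow> P n S"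
    using assms(1) unfolding unavoidable_def by blast
  obtain \<beta>' \<gamma>' :: real where b': "\<beta>' > 0" "\<gamma>' > 0" "\<gamma>' < ?q"
    "\<forall>n. \<forall>S \<subseteq> vecs n. real (card S) \<ge> \<beta>' * \<gamma>' ^ n \<longrightarrow> Q n S"
    using assms(2) unfolding unavoidable_def by blast
  have "\<beta> * \<gamma> ^ n \<le> max \<beta> \<beta>' * max \<gamma> \<gamma>' ^ n" "\<beta>' * \<gamma>' ^ n \<le> max \<beta> \<beta>' * max \<gamma> \<gamma>' ^ n" for n
    using b b' by (auto intro!: mult_mono power_mono)
  then have "P n S \<and> Q n S" if "S \<subseteq> vecs n" "real (card S) \<ge> max \<beta> \<beta>' * max \<gamma> \<gamma>' ^ n" for n S
    using b(4) b'(4) that order_trans by metis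
  then show ?thesis unfolding unavoidable_def using b(1-3) b'(1-3)
    by (intro exI[of _ "max \<beta> \<beta>'"] exI[of _ "max \<gamma> \<gamma>'"]) auto
qed

lemma unavoidable_card_ge:
  "unavoidable (\<lambda>n (S :: (nat \<Rightarrow> 'a::{field,finite}) set). card S \<ge> N)"
  unfolding unavoidable_def using card_field_ge_2[where 'a='a]
  by (intro exI[of _ "real N + 1"] exI[of _ 1]) auto

lemma unavoidable_ball:
  fixes P :: "'b \<Rightarrow> nat \<Rightarrow> (nat \<Rightarrow> 'a::{field,finite}) set \<Rightarrow> bool"
  assumes "finite I" "\<And>i. i \<in> I \<Longrightarrow> unavoidable (P i)"
  shows "unavoidable (\<lambda>n S. \<forall>i\<in>I. P i n S)"
  using assms
proof (induction I)
  case empty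
  show ?case by (rule unavoidable_mono[OF unavoidable_card_ge[of 0]]) simp
next
  case (insert i I)
  then show ?case
    using unavoidable_conj[of "P i" "\<lambda>n S. \<forall>i\<in>I. P i n S"] by simp
qed

text \<open>Losing a constant factor in the size of the set only changes \<beta>. The new constant
  has the factor \<open>c + 1\<close> instead of \<open>c\<close> so that it stays positive for
  \<open>c = 0\<close>.\<close>

lemma unavoidable_dense_subset:
  fixes P :: "nat \<Rightarrow> (nat \<Rightarrow> 'a::{field,finite}) set \<Rightarrow> bool"
  assumes "unavoidable P"
  shows "unavoidable (\<lambda>n S. \<forall>T\<subseteq>S. card S \<le> c * card T \<longrightarrow> P n T)"
proof -
  obtain \<beta> \<gamma> :: real where b: "\<beta> > 0" "\<gamma> > 0" "\<gamma> < real (card (UNIV :: 'a set))"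
    "\<And>n S. S \<subseteq> vecs n \<Longrightarrow> real (card S) \<ge> \<beta> * \<gamma> ^ n \<Longrightarrow> P n S"
    using assms(1) unfolding unavoidable_def by blast
  have "P n T" if "S \<subseteq> vecs n" "real (card S) \<ge> (real c + 1) * \<beta> * \<gamma> ^ n" "T \<subseteq> S" "card S \<le> c * card T"
    for n S T
  proof (rule b(4))
    have "(real c + 1) * (\<beta> * \<gamma> ^ n) \<le> (real c + 1) * real (card T)"
    proof -
      have "(real c + 1) * (\<beta> * \<gamma> ^ n) \<le> real (card S)" using that by (simp add: mult.assoc)
      also have "\<dots> \<le> real (c * card T)" using that by (intro of_nat_mono) auto
      also have "\<dots> \<le> (real c + 1) * real (card T)" by (simp add: algebra_simps)
      finally show ?thesis .
    qed
    then show "\<beta> * \<gamma> ^ n \<le> real (card T)" by (rule mult_left_le_imp_le) auto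
  qed (use that in auto)
  then show ?thesis unfolding unavoidable_def using b
    by (intro exI[of _ "(real c + 1) * \<beta>"] exI[of _ \<gamma>]) auto
qed

section \<open>Three variables: the slice rank bound\<close>

text \<open>Gaussian elimination, where \<open>Z\<close> is the set of pivots.\<close>

lemma orthogonal_extension:
  fixes p :: "'i \<Rightarrow> 'x \<Rightarrow> 'a::field"
  assumes "finite I" "finite S"
  shows "\<exists>Z\<subseteq>S. card Z \<le> card I \<and>
    (\<forall>g. \<exists>h. (\<forall>x\<in>S - Z. h x = g x) \<and> (\<forall>i\<in>I. (\<Sum>x\<in>S. h x * p i x) = 0))"
  using assms
proof (induction I arbitrary: S p)
  case empty
  show ?case by (intro exI[of _ "{}"]) auto
next
  case (insert i I)
  show ?case
  proof (cases "\<forall>x\<in>S. p i x = 0")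
    case True
    obtain Z where Z: "Z \<subseteq> S" "card Z \<le> card I"
      "\<forall>g. \<exists>h. (\<forall>x\<in>S - Z. h x = g x) \<and> (\<forall>i\<in>I. (\<Sum>x\<in>S. h x * p i x) = 0)"
      using insert.IH[OF insert.prems, of p] by blast
    have "(\<Sum>x\<in>S. h x * p i x) = 0" for h using True by simp
    then show ?thesis using Z insert.hyps by (intro exI[of _ Z]) auto
  next
    case False
    then obtain s where s: "s \<in> S" "p i s \<noteq> 0" by blast
    \<comment> \<open>Subtracting a multiple of \<open>p i\<close> makes every \<open>p' j\<close>
      vanish at the pivot \<open>s\<close>, so the remaining conditions live on
      \<open>S - {s}\<close>.\<close>
    define p' where "p' = (\<lambda>j x. p j x - p j s / p i s * p i x)"
    obtain Z where Z: "Z \<subseteq> S - {s}" "card Z \<le> card I"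
      "\<And>g. \<exists>h. (\<forall>x\<in>S - {s} - Z. h x = g x) \<and> (\<forall>j\<in>I. (\<Sum>x\<in>S - {s}. h x * p' j x) = 0)"
      using insert.IH[of "S - {s}" p'] insert.prems by auto
    have "\<exists>h. (\<forall>x\<in>S - insert s Z. h x = g x) \<and> (\<forall>j\<in>insert i I. (\<Sum>x\<in>S. h x * p j x) = 0)" for g
    proof -
      obtain h where h: "\<forall>x\<in>S - {s} - Z. h x = g x" "\<forall>j\<in>I. (\<Sum>x\<in>S - {s}. h x * p' j x) = 0"
        using Z(3) by blast
      define r where "r = (\<Sum>x\<in>S - {s}. h x * p i x)"
      \<comment> \<open>The value at the pivot is free, and this choice is the one that satisfies
        condition \<open>i\<close>.\<close>
      define h' where "h' = h(s := - r / p i s)"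
      have split: "(\<Sum>x\<in>S. h' x * p j x) = - r / p i s * p j s + (\<Sum>x\<in>S - {s}. h x * p j x)" for j
        using s insert.prems by (subst sum.remove[of _ s]) (auto simp: h'_def intro!: sum.cong)
      have i: "(\<Sum>x\<in>S. h' x * p i x) = 0" using s by (simp add: split r_def)
      have "(\<Sum>x\<in>S. h' x * p j x) = 0" if "j \<in> I" for j
      proof -
        have "0 = (\<Sum>x\<in>S - {s}. h x * p' j x)" using h that by simp
        also have "\<dots> = (\<Sum>x\<in>S - {s}. h x * p j x) - p j s / p i s * r"
          by (simp add: p'_def r_def sum_subtractf right_diff_distrib sum_distrib_left mult_ac)
        finally show ?thesis by (simp add: split)
      qed
      then show ?thesis using h i by (intro exI[of _ h']) (auto simp: h'_def)
    qed
    moreover have "card (insert s Z) \<le> card (insert i I)"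
      using Z insert finite_subset[OF Z(1)] by (auto simp: card_insert_if)
    ultimately show ?thesis using s Z by (intro exI[of _ "insert s Z"]) auto
  qed
qed

text \<open>A diagonal tensor with nonzero diagonal on \<open>S\<close> has slice rank
  \<open>card S\<close>, while the expansion is a sum of at most \<open>3 * card L\<close> slices.
  To see the bound, contract the third variable with a vector \<open>h\<close> orthogonal to all
  \<open>F e\<close> with \<open>e\<close> in \<open>L\<close>. This kills the terms whose third
  factor lies in \<open>L\<close> and leaves a diagonal matrix that is invertible on all but
  \<open>card L\<close> points. The remaining terms have their first or second factor in
  \<open>L\<close>, so that matrix has rank at most \<open>2 * card L\<close>; a second contraction
  makes this a contradiction.\<close>

lemma diagonal_slice_rank:
  fixes T :: "'x \<Rightarrow> 'x \<Rightarrow> 'x \<Rightarrow> 'a::field" and F :: "'e \<Rightarrow> 'x \<Rightarrow> 'a" and \<alpha> \<beta> \<gamma> :: "'p \<Rightarrow> 'e"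
  assumes fin: "finite S" "finite \<Omega>" "finite L"
    and T: "\<And>x y z. \<lbrakk>x \<in> S; y \<in> S; z \<in> S\<rbrakk> \<Longrightarrow>
          T x y z = (\<Sum>w\<in>\<Omega>. \<kappa> w * F (\<alpha> w) x * F (\<beta> w) y * F (\<gamma> w) z)"
    and L: "\<And>w. w \<in> \<Omega> \<Longrightarrow> \<alpha> w \<in> L \<or> \<beta> w \<in> L \<or> \<gamma> w \<in> L"
    and diag: "\<And>x. x \<in> S \<Longrightarrow> T x x x \<noteq> 0"
    and off: "\<And>x y z. \<lbrakk>x \<in> S; y \<in> S; z \<in> S; x \<noteq> y \<or> y \<noteq> z\<rbrakk> \<Longrightarrow> T x y z = 0"
  shows "card S \<le> 3 * card L"
proof (rule ccontr)
  assume "\<not> card S \<le> 3 * card L"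
  obtain Z where Z: "Z \<subseteq> S" "card Z \<le> card L"
    "\<forall>g. \<exists>h. (\<forall>x\<in>S - Z. h x = g x) \<and> (\<forall>e\<in>L. (\<Sum>x\<in>S. h x * F e x) = 0)"
    using orthogonal_extension[OF fin(3) fin(1), of F] by blast
  then obtain h where h: "\<forall>x\<in>S - Z. h x = 1" "\<forall>e\<in>L. (\<Sum>x\<in>S. h x * F e x) = 0"
    by (meson Z(3)[rule_format, of "\<lambda>_. 1"])
  define S' where "S' = S - Z"
  have S': "finite S'" "S' \<subseteq> S" "card S' > 2 * card L"
    using fin Z \<open>\<not> card S \<le> 3 * card L\<close> card_Diff_subset[of Z S] finite_subset[OF Z(1)]
    by (auto simp: S'_def)
  define \<Omega>' where "\<Omega>' = {w\<in>\<Omega>. \<gamma> w \<notin> L}"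
  define k where "k w = \<kappa> w * (\<Sum>z\<in>S. h z * F (\<gamma> w) z)" for w
  have k0: "k w = 0" if "w \<in> \<Omega> - \<Omega>'" for w using that h by (auto simp: k_def \<Omega>'_def)
  have contract: "(\<Sum>z\<in>S. h z * T x y z) = (\<Sum>w\<in>\<Omega>'. k w * F (\<alpha> w) x * F (\<beta> w) y)"
    if "x \<in> S" "y \<in> S" for x y
  proof -
    have "(\<Sum>z\<in>S. h z * T x y z) = (\<Sum>z\<in>S. \<Sum>w\<in>\<Omega>. \<kappa> w * (h z * F (\<gamma> w) z) * F (\<alpha> w) x * F (\<beta> w) y)"
      using that by (intro sum.cong refl) (simp add: T sum_distrib_left mult_ac)
    also have "\<dots> = (\<Sum>w\<in>\<Omega>. k w * F (\<alpha> w) x * F (\<beta> w) y)"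
      by (subst sum.swap) (simp add: k_def sum_distrib_left sum_distrib_right mult_ac)
    also have "\<dots> = (\<Sum>w\<in>\<Omega>'. k w * F (\<alpha> w) x * F (\<beta> w) y)"
      using fin k0 by (intro sum.mono_neutral_right) (auto simp: \<Omega>'_def)
    finally show ?thesis .
  qed
  have contract': "(\<Sum>z\<in>S. h z * T x y z) = (if x = y then T x x x else 0)"
    if "x \<in> S'" "y \<in> S'" for x y
  proof -
    have "(\<Sum>z\<in>S. h z * T x y z) = (\<Sum>z\<in>{y}. h z * T x y z)"
    proof (rule sum.mono_neutral_right)
      show "\<forall>z\<in>S - {y}. h z * T x y z = 0" using that S' off[of x y] by (auto simp: subset_iff)
    qed (use that S' fin in auto)
    then show ?thesis using that S' off[of x y y] h by (auto simp: S'_def)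
  qed
  \<comment> \<open>The second vector \<open>u\<close> must satisfy two kinds of conditions:
    \<open>Inl e\<close> kills the terms with first factor \<open>F e\<close>, and
    \<open>Inr e\<close> kills the collected coefficient of the second factor
    \<open>F e\<close>.\<close>
  define p where "p i = (case i of Inl e \<Rightarrow> F e
     | Inr e \<Rightarrow> (\<lambda>x. \<Sum>w\<in>{w\<in>\<Omega>'. \<beta> w = e}. k w * F (\<alpha> w) x))" for i :: "'e + 'e"
  have finL: "finite (L <+> L)" "card (L <+> L) = 2 * card L" using fin by (auto simp: card_Plus)
  obtain Y where Y: "Y \<subseteq> S'" "card Y \<le> 2 * card L"
    "\<forall>g. \<exists>u. (\<forall>x\<in>S' - Y. u x = g x) \<and> (\<forall>i\<in>L <+> L. (\<Sum>x\<in>S'. u x * p i x) = 0)"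
    using orthogonal_extension[OF finL(1) S'(1), of p] finL by auto
  then obtain u where u: "\<forall>x\<in>S' - Y. u x = 1" "\<forall>i\<in>L <+> L. (\<Sum>x\<in>S'. u x * p i x) = 0"
    by (meson Y(3)[rule_format, of "\<lambda>_. 1"])
  have "\<not> S' \<subseteq> Y" using Y S' card_mono[of Y S'] finite_subset[OF Y(1)] by auto
  then obtain y where y: "y \<in> S'" "y \<notin> Y" by blast
  define \<Psi> where "\<Psi> = {w\<in>\<Omega>'. \<alpha> w \<notin> L}"
  have "(\<Sum>x\<in>S'. u x * (\<Sum>z\<in>S. h z * T x y z)) = (\<Sum>x\<in>S'. if x = y then T y y y else 0)"
    using y u by (intro sum.cong refl) (auto simp: contract')
  also have "\<dots> \<noteq> 0" using y S' diag by auto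
  finally have nz: "(\<Sum>x\<in>S'. u x * (\<Sum>z\<in>S. h z * T x y z)) \<noteq> 0" .
  have "(\<Sum>x\<in>S'. u x * (\<Sum>z\<in>S. h z * T x y z))
      = (\<Sum>x\<in>S'. \<Sum>w\<in>\<Omega>'. u x * (k w * F (\<alpha> w) x * F (\<beta> w) y))"
    using y S' by (intro sum.cong refl) (auto simp: contract sum_distrib_left subset_iff)
  also have "\<dots> = (\<Sum>w\<in>\<Omega>'. k w * (\<Sum>x\<in>S'. u x * F (\<alpha> w) x) * F (\<beta> w) y)"
    by (subst sum.swap) (simp add: sum_distrib_left sum_distrib_right mult_ac)
  also have "\<dots> = (\<Sum>w\<in>\<Psi>. k w * (\<Sum>x\<in>S'. u x * F (\<alpha> w) x) * F (\<beta> w) y)"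
  proof (rule sum.mono_neutral_right)
    show "\<forall>w\<in>\<Omega>' - \<Psi>. k w * (\<Sum>x\<in>S'. u x * F (\<alpha> w) x) * F (\<beta> w) y = 0"
      using u(2) by (auto simp: \<Psi>_def p_def dest: bspec[of _ _ "Inl _"])
  qed (use fin in \<open>auto simp: \<Psi>_def \<Omega>'_def\<close>)
  also have "\<dots> = (\<Sum>e\<in>L. \<Sum>w | w \<in> \<Psi> \<and> \<beta> w = e. k w * (\<Sum>x\<in>S'. u x * F (\<alpha> w) x) * F (\<beta> w) y)"
    using fin L by (intro sum.group[symmetric]) (auto simp: \<Psi>_def \<Omega>'_def)
  \<comment> \<open>The terms with first factor in \<open>L\<close> are put back, which changes
    nothing because of the conditions \<open>Inl\<close>. Now the inner sum over all terms with
    second factor \<open>F e\<close> is the one that the condition \<open>Inr e\<close>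
    annihilates.\<close>
  also have "\<dots> = (\<Sum>e\<in>L. \<Sum>w | w \<in> \<Omega>' \<and> \<beta> w = e. k w * (\<Sum>x\<in>S'. u x * F (\<alpha> w) x) * F (\<beta> w) y)"
  proof (rule sum.cong[OF refl], rule sum.mono_neutral_left)
    fix e assume "e \<in> L"
    show "\<forall>w\<in>{w. w \<in> \<Omega>' \<and> \<beta> w = e} - {w. w \<in> \<Psi> \<and> \<beta> w = e}.
        k w * (\<Sum>x\<in>S'. u x * F (\<alpha> w) x) * F (\<beta> w) y = 0"
      using u(2) by (auto simp: \<Psi>_def p_def dest: bspec[of _ _ "Inl _"])
  qed (use fin in \<open>auto simp: \<Psi>_def \<Omega>'_def\<close>)
  also have "\<dots> = (\<Sum>e\<in>L. (\<Sum>x\<in>S'. u x * p (Inr e) x) * F e y)"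
  proof (intro sum.cong refl)
    fix e assume "e \<in> L"
    have "(\<Sum>x\<in>S'. u x * p (Inr e) x) = (\<Sum>w | w \<in> \<Omega>' \<and> \<beta> w = e. k w * (\<Sum>x\<in>S'. u x * F (\<alpha> w) x))"
      unfolding p_def sum_distrib_left by (subst sum.swap) (simp add: mult_ac sum_distrib_left)
    then show "(\<Sum>w | w \<in> \<Omega>' \<and> \<beta> w = e. k w * (\<Sum>x\<in>S'. u x * F (\<alpha> w) x) * F (\<beta> w) y)
      = (\<Sum>x\<in>S'. u x * p (Inr e) x) * F e y"
      by (simp add: sum_distrib_right)
  qed
  also have "\<dots> = 0" using u(2) by (intro sum.neutral) auto
  finally show False using nz by blast
qed

section \<open>The indicator of a linear equation as a polynomial of low degree\<close>

lemma finite_field_power_card_minus_1: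
  fixes x :: "'a::{field,finite}"
  assumes "x \<noteq> 0"
  shows "x ^ (card (UNIV :: 'a set) - 1) = 1"
proof -
  let ?P = "\<Prod>y\<in>UNIV - {0 :: 'a}. y"
  have "bij_betw ((*) x) (UNIV - {0}) (UNIV - {0})"
    using assms by (intro bij_betwI[where g = "\<lambda>y. y / x"]) auto
  then have "(\<Prod>y\<in>UNIV - {0}. x * y) = ?P" by (rule prod.reindex_bij_betw)
  then have "x ^ card (UNIV - {0 :: 'a}) * ?P = ?P" by (simp add: prod.distrib)
  moreover have "?P \<noteq> 0" by simp
  ultimately show ?thesis by (simp add: card_Diff_singleton)
qed

definition exps3 :: "nat \<Rightarrow> (nat \<times> nat \<times> nat) set" where
  "exps3 e = {(i, j, l). i + j + l \<le> e}"

lemma finite_exps3 [simp]: "finite (exps3 e)"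
  by (rule finite_subset[of _ "{..e} \<times> {..e} \<times> {..e}"]) (auto simp: exps3_def)

text \<open>The polynomial \<open>1 - u ^ (q - 1)\<close> is the indicator of \<open>u = 0\<close>
  over a field with \<open>q\<close> elements. Substituting the linear form for \<open>u\<close>
  gives only monomials of total degree at most \<open>q - 1\<close>.\<close>

lemma zero_indicator_expansion:
  fixes a b c :: "'a::{field,finite}"
  shows "\<exists>\<kappa> :: nat \<times> nat \<times> nat \<Rightarrow> 'a. \<forall>x y z. (if a * x + b * y + c * z = 0 then 1 else 0)
    = (\<Sum>p\<in>exps3 (card (UNIV :: 'a set) - 1). \<kappa> p * x ^ fst p * y ^ fst (snd p) * z ^ snd (snd p))"
proof -
  define e where "e = card (UNIV :: 'a set) - 1"
  have e: "e \<ge> 1" using card_field_ge_2[where 'a='a] by (simp add: e_def)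
  \<comment> \<open>The coefficients of the power of the linear form, with the trinomial coefficient
    written as two binomial ones so that the binomial theorem can be applied twice.\<close>
  define \<mu> :: "nat \<times> nat \<times> nat \<Rightarrow> 'a" where "\<mu> = (\<lambda>(i, j, l). if i + j + l = e
    then of_nat (e choose i) * of_nat ((e - i) choose j) * a ^ i * b ^ j * c ^ l else 0)"
  define \<kappa> where "\<kappa> p = (if p = (0, 0, 0) then 1 else 0) - \<mu> p" for p
  have "(if a * x + b * y + c * z = 0 then 1 else 0)
    = (\<Sum>p\<in>exps3 e. \<kappa> p * x ^ fst p * y ^ fst (snd p) * z ^ snd (snd p))" for x y z
  proof -
    have "(\<Sum>p\<in>exps3 e. \<mu> p * x ^ fst p * y ^ fst (snd p) * z ^ snd (snd p))
      = (\<Sum>p | p \<in> exps3 e \<and> fst p + fst (snd p) + snd (snd p) = e.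
          \<mu> p * x ^ fst p * y ^ fst (snd p) * z ^ snd (snd p))"
      by (rule sum.mono_neutral_right) (auto simp: \<mu>_def)
    also have "\<dots> = (\<Sum>(i, j)\<in>Sigma {..e} (\<lambda>i. {..e - i}). \<mu> (i, j, e - i - j) * x ^ i * y ^ j * z ^ (e - i - j))"
      by (rule sum.reindex_bij_witness
            [where i = "\<lambda>(i, j). (i, j, e - i - j)" and j = "\<lambda>p. (fst p, fst (snd p))"])
         (auto simp: exps3_def)
    also have "\<dots> = (\<Sum>i\<le>e. \<Sum>j\<le>e - i. \<mu> (i, j, e - i - j) * x ^ i * y ^ j * z ^ (e - i - j))"
      by (rule sum.Sigma[symmetric]) auto
    also have "\<dots> = (\<Sum>i\<le>e. of_nat (e choose i) * (a * x) ^ i * (b * y + c * z) ^ (e - i))"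
    proof (rule sum.cong[OF refl])
      fix i assume "i \<in> {..e}"
      then have "\<mu> (i, j, e - i - j) * x ^ i * y ^ j * z ^ (e - i - j)
        = of_nat (e choose i) * (a * x) ^ i *
            (of_nat ((e - i) choose j) * (b * y) ^ j * (c * z) ^ (e - i - j))" if "j \<le> e - i" for j
        using that by (simp add: \<mu>_def power_mult_distrib mult_ac)
      then show "(\<Sum>j\<le>e - i. \<mu> (i, j, e - i - j) * x ^ i * y ^ j * z ^ (e - i - j))
        = of_nat (e choose i) * (a * x) ^ i * (b * y + c * z) ^ (e - i)"
        unfolding binomial_ring[of "b * y" "c * z"] sum_distrib_left by (intro sum.cong refl) simp
    qed
    also have "\<dots> = (a * x + b * y + c * z) ^ e"
      unfolding add.assoc by (rule binomial_ring[symmetric])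
    finally have 1: "(\<Sum>p\<in>exps3 e. \<mu> p * x ^ fst p * y ^ fst (snd p) * z ^ snd (snd p))
      = (a * x + b * y + c * z) ^ e" .
    have "(\<Sum>p\<in>exps3 e. (if p = (0, 0, 0) then 1 else 0) * x ^ fst p * y ^ fst (snd p) * z ^ snd (snd p))
      = (\<Sum>p\<in>exps3 e. if p = (0, 0, 0) then 1 else 0)"
      by (intro sum.cong) auto
    also have "\<dots> = 1" by (subst sum.delta[OF finite_exps3]) (auto simp: exps3_def)
    finally have "(\<Sum>p\<in>exps3 e. \<kappa> p * x ^ fst p * y ^ fst (snd p) * z ^ snd (snd p))
      = 1 - (a * x + b * y + c * z) ^ e"
      by (simp add: \<kappa>_def left_diff_distrib sum_subtractf 1)
    also have "\<dots> = (if a * x + b * y + c * z = 0 then 1 else 0)"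
      using finite_field_power_card_minus_1[of "a * x + b * y + c * z", folded e_def] e by auto
    finally show ?thesis by simp
  qed
  then show ?thesis unfolding e_def by blast
qed

section \<open>Counting monomials of low degree\<close>

definition low_exps :: "nat \<Rightarrow> nat \<Rightarrow> (nat \<Rightarrow> nat) set" where
  "low_exps q n = {e \<in> PiE {..<n} (\<lambda>_. {..<q}). 3 * (\<Sum>t<n. e t) \<le> n * (q - 1)}"

lemma finite_low_exps [simp]: "finite (low_exps q n)"
  unfolding low_exps_def by (rule finite_subset[of _ "PiE {..<n} (\<lambda>_. {..<q})"]) (auto intro: finite_PiE)

text \<open>An exponential moment bound. For \<open>0 < r < 1\<close> each low exponent vector has
  weight \<open>r ^ (3 * sum)\<close> at least \<open>r ^ (n * (q - 1))\<close>, while the weights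
  of all exponent vectors add up to the \<open>n\<close>-th power of a sum over one coordinate. The
  resulting base \<gamma> equals \<open>q\<close> at \<open>r = 1\<close>. Since the average of
  \<open>3 * i\<close> over \<open>i < q\<close> exceeds \<open>q - 1\<close>, the base drops below
  \<open>q\<close> when \<open>r\<close> is slightly less than 1.\<close>

lemma card_low_exps:
  assumes "q \<ge> 2"
  shows "\<exists>\<gamma>>0. \<gamma> < real q \<and> (\<forall>n. real (card (low_exps q n)) \<le> \<gamma> ^ n)"
proof -
  \<comment> \<open>\<open>g 1 = 0\<close>, and \<open>g r > 0\<close> says that the base belonging
    to \<open>r\<close> is less than \<open>q\<close>; hence a negative derivative at 1
    suffices.\<close>
  define g where "g r = real q * r ^ (q - 1) - (\<Sum>i<q. r ^ (3 * i))" for r :: real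
  have "(g has_real_derivative (real q * real (q - 1) - (\<Sum>i<q. real (3 * i)))) (at 1)"
    unfolding g_def by (auto intro!: derivative_eq_intros sum.cong)
  moreover have "real q * real (q - 1) - (\<Sum>i<q. real (3 * i)) < 0"
  proof -
    have "2 * (\<Sum>i<q. i) = q * (q - 1)" for q :: nat by (induction q) (auto simp: algebra_simps)
    then have "2 * (\<Sum>i<q. 3 * i) = 3 * (q * (q - 1))" by (simp flip: sum_distrib_left)
    then have "real (2 * (\<Sum>i<q. 3 * i)) = real (3 * (q * (q - 1)))" by presburger
    then have "2 * (\<Sum>i<q. real (3 * i)) = 3 * (real q * real (q - 1))"
      unfolding of_nat_mult of_nat_sum by simp
    moreover have "real q * real (q - 1) > 0" using assms by auto
    ultimately show ?thesis by linarith
  qed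
  ultimately obtain d where d: "d > 0" "\<And>h. \<lbrakk>h > 0; h < d\<rbrakk> \<Longrightarrow> g 1 < g (1 - h)"
    using DERIV_neg_dec_left by blast
  \<comment> \<open>A point within distance \<open>d\<close> to the left of 1; the minimum with 1
    keeps it positive.\<close>
  define r where "r = 1 - min d 1 / 2"
  have r: "0 < r" "r < 1" using d by (auto simp: r_def min_def)
  have "g 1 < g r" unfolding r_def using d(1) by (intro d(2)) (auto simp: min_def)
  then have gr: "(\<Sum>i<q. r ^ (3 * i)) < real q * r ^ (q - 1)" by (simp add: g_def)
  define \<gamma> where "\<gamma> = (\<Sum>i<q. r ^ (3 * i)) / r ^ (q - 1)"
  have "(\<Sum>i<q. r ^ (3 * i)) > 0" using assms r by (intro sum_pos) (auto simp: lessThan_empty_iff)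
  then have "\<gamma> > 0" using r by (simp add: \<gamma>_def)
  moreover have "\<gamma> < real q" using gr r by (simp add: \<gamma>_def divide_less_eq)
  moreover have "real (card (low_exps q n)) \<le> \<gamma> ^ n" for n
  proof -
    have "real (card (low_exps q n)) * r ^ (n * (q - 1)) = (\<Sum>e\<in>low_exps q n. r ^ (n * (q - 1)))" by simp
    also have "\<dots> \<le> (\<Sum>e\<in>low_exps q n. \<Prod>t<n. r ^ (3 * e t))"
    proof (rule sum_mono)
      fix e assume "e \<in> low_exps q n"
      then have "3 * (\<Sum>t<n. e t) \<le> n * (q - 1)" by (simp add: low_exps_def)
      then have "r ^ (n * (q - 1)) \<le> r ^ (3 * (\<Sum>t<n. e t))" using r by (intro power_decreasing) auto
      also have "\<dots> = (\<Prod>t<n. r ^ (3 * e t))" by (simp add: sum_distrib_left power_sum)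
      finally show "r ^ (n * (q - 1)) \<le> (\<Prod>t<n. r ^ (3 * e t))" .
    qed
    also have "\<dots> \<le> (\<Sum>e\<in>PiE {..<n} (\<lambda>_. {..<q}). \<Prod>t<n. r ^ (3 * e t))"
    proof (rule sum_mono2)
      show "finite (PiE {..<n} (\<lambda>_. {..<q}))" by (simp add: finite_PiE)
      show "low_exps q n \<subseteq> PiE {..<n} (\<lambda>_. {..<q})" by (auto simp: low_exps_def)
      show "0 \<le> (\<Prod>t<n. r ^ (3 * e t))" for e using r by (intro prod_nonneg) simp
    qed
    also have "\<dots> = (\<Prod>t<n. \<Sum>i<q. r ^ (3 * i))" by (subst prod_sum_PiE) auto
    also have "\<dots> = (\<gamma> * r ^ (q - 1)) ^ n" using r by (simp add: \<gamma>_def)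
    also have "\<dots> = \<gamma> ^ n * r ^ (n * (q - 1))" by (simp add: power_mult_distrib power_mult[symmetric] mult.commute)
    finally show ?thesis using r by simp
  qed
  ultimately show ?thesis by blast
qed

text \<open>The indicator of the equation, restricted to \<open>S\<close>, is a diagonal tensor: a
  solution in \<open>S\<close> has two equal entries, and then balance makes all three equal.
  Multiplying the one-coordinate expansions gives a polynomial of total degree at most
  \<open>n * (q - 1)\<close>, so every monomial has a factor in \<open>low_exps\<close> and the
  slice rank bound applies.\<close>

lemma three_variables_card_bound:
  fixes a b c :: "'a::{field,finite}"
  assumes nz: "a \<noteq> 0" "b \<noteq> 0" "c \<noteq> 0" and bal: "a + b + c = 0" and S: "S \<subseteq> vecs n"
    and avoid: "\<And>x y z. \<lbrakk>x \<in> S; y \<in> S; z \<in> S; \<forall>t. a * x t + b * y t + c * z t = 0\<rbrakk> \<Longrightarrow>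
      x = y \<or> y = z \<or> x = z"
  shows "card S \<le> 3 * card (low_exps (card (UNIV :: 'a set)) n)"
proof -
  define q where "q = card (UNIV :: 'a set)"
  obtain \<kappa> :: "nat \<times> nat \<times> nat \<Rightarrow> 'a" where \<kappa>: "\<And>x y z. (if a * x + b * y + c * z = 0 then 1 else 0)
    = (\<Sum>p\<in>exps3 (q - 1). \<kappa> p * x ^ fst p * y ^ fst (snd p) * z ^ snd (snd p))"
    using zero_indicator_expansion[of a b c] unfolding q_def by blast
  define T :: "(nat \<Rightarrow> 'a) \<Rightarrow> (nat \<Rightarrow> 'a) \<Rightarrow> (nat \<Rightarrow> 'a) \<Rightarrow> 'a" where
    "T x y z = (\<Prod>t<n. if a * x t + b * y t + c * z t = 0 then 1 else 0)" for x y z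
  define F :: "(nat \<Rightarrow> nat) \<Rightarrow> (nat \<Rightarrow> 'a) \<Rightarrow> 'a" where "F e x = (\<Prod>t<n. x t ^ e t)" for e x
  define \<Omega> where "\<Omega> = PiE {..<n} (\<lambda>_. exps3 (q - 1))"
  define \<alpha> where "\<alpha> g = restrict (\<lambda>t. fst (g t)) {..<n}" for g :: "nat \<Rightarrow> nat \<times> nat \<times> nat"
  define \<beta> where "\<beta> g = restrict (\<lambda>t. fst (snd (g t))) {..<n}" for g :: "nat \<Rightarrow> nat \<times> nat \<times> nat"
  define \<gamma> where "\<gamma> g = restrict (\<lambda>t. snd (snd (g t))) {..<n}" for g :: "nat \<Rightarrow> nat \<times> nat \<times> nat"
  have q: "q \<ge> 2" using card_field_ge_2[where 'a='a] by (simp add: q_def)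
  have T0: "T x y z = 0 \<or> (\<forall>t. a * x t + b * y t + c * z t = 0)" if "x \<in> S" "y \<in> S" "z \<in> S" for x y z
  proof (cases "\<forall>t<n. a * x t + b * y t + c * z t = 0")
    case True
    have "a * x t + b * y t + c * z t = 0" if "t \<ge> n" for t
    proof -
      have "x t = 0" "y t = 0" "z t = 0"
        using that S \<open>x \<in> S\<close> \<open>y \<in> S\<close> \<open>z \<in> S\<close> unfolding vecs_def by blast+
      then show ?thesis by simp
    qed
    with True show ?thesis by (meson not_le)
  qed (auto simp: T_def)
  \<comment> \<open>If two variables coincide, eliminating a coefficient by
    \<open>a + b + c = 0\<close> leaves a nonzero coefficient times a difference.\<close>
  have merge: "x = y \<and> y = z" if "x = y \<or> y = z \<or> x = z" "\<forall>t. a * x t + b * y t + c * z t = 0"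
    for x y z :: "nat \<Rightarrow> 'a"
  proof -
    have ab: "a = - b - c" "b = - a - c" "c = - a - b"
      using bal by algebra+
    have "x t = y t \<and> y t = z t" for t
    proof -
      have *: "a * x t + b * y t + c * z t = 0" using that(2) by blast
      from that(1) consider "x t = y t" | "y t = z t" | "x t = z t" by auto
      then show ?thesis
      proof cases
        case 1
        then have "c * (z t - y t) = 0" using * by (subst (asm) ab(1)) (simp add: algebra_simps)
        then show ?thesis using nz 1 by simp
      next
        case 2
        then have "a * (x t - y t) = 0" using * by (subst (asm) ab(2)) (simp add: algebra_simps)
        then show ?thesis using nz 2 by simp
      next
        case 3
        then have "b * (y t - z t) = 0" using * by (subst (asm) ab(1)) (simp add: algebra_simps)
        then show ?thesis using nz 3 by simp
      qed
    qed
    then show ?thesis by blast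
  qed
  have "card S \<le> 3 * card (low_exps q n)"
  proof (rule diagonal_slice_rank)
    show "finite S" using S by (rule finite_subset_vecs)
    show "finite \<Omega>" by (auto simp: \<Omega>_def intro: finite_PiE)
    show "finite (low_exps q n)" by simp
    show "T x y z = (\<Sum>w\<in>\<Omega>. (\<Prod>t<n. \<kappa> (w t)) * F (\<alpha> w) x * F (\<beta> w) y * F (\<gamma> w) z)" for x y z
    proof -
      have "T x y z = (\<Prod>t<n. \<Sum>p\<in>exps3 (q - 1).
          \<kappa> p * x t ^ fst p * y t ^ fst (snd p) * z t ^ snd (snd p))"
        unfolding T_def \<kappa> ..
      also have "\<dots> = (\<Sum>w\<in>\<Omega>. \<Prod>t<n.
          \<kappa> (w t) * x t ^ fst (w t) * y t ^ fst (snd (w t)) * z t ^ snd (snd (w t)))"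
        unfolding \<Omega>_def by (rule prod_sum_PiE) auto
      also have "\<dots> = (\<Sum>w\<in>\<Omega>. (\<Prod>t<n. \<kappa> (w t)) * F (\<alpha> w) x * F (\<beta> w) y * F (\<gamma> w) z)"
        by (simp add: prod.distrib F_def \<alpha>_def \<beta>_def \<gamma>_def)
      finally show ?thesis .
    qed
    \<comment> \<open>The three partial degrees add up to at most \<open>n * (q - 1)\<close>, so one
      of them is at most a third of this.\<close>
    show "\<alpha> w \<in> low_exps q n \<or> \<beta> w \<in> low_exps q n \<or> \<gamma> w \<in> low_exps q n" if "w \<in> \<Omega>" for w
    proof -
      have w: "fst (w t) + fst (snd (w t)) + snd (snd (w t)) \<le> q - 1" if "t < n" for t
        using that \<open>w \<in> \<Omega>\<close> by (force simp: \<Omega>_def exps3_def PiE_iff)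
      then have "(\<Sum>t<n. fst (w t) + fst (snd (w t)) + snd (snd (w t))) \<le> (\<Sum>t<n. q - 1)"
        by (intro sum_mono) auto
      then have sum: "(\<Sum>t<n. \<alpha> w t) + (\<Sum>t<n. \<beta> w t) + (\<Sum>t<n. \<gamma> w t) \<le> n * (q - 1)"
        by (simp add: \<alpha>_def \<beta>_def \<gamma>_def sum.distrib)
      have "fst (w t) < q" "fst (snd (w t)) < q" "snd (snd (w t)) < q" if "t < n" for t
        using w[OF that] q by linarith+
      then have mem: "\<alpha> w \<in> PiE {..<n} (\<lambda>_. {..<q})" "\<beta> w \<in> PiE {..<n} (\<lambda>_. {..<q})"
        "\<gamma> w \<in> PiE {..<n} (\<lambda>_. {..<q})" by (auto simp: \<alpha>_def \<beta>_def \<gamma>_def)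
      show ?thesis
      proof (rule ccontr)
        assume "\<not> ?thesis"
        then have "3 * (\<Sum>t<n. \<alpha> w t) > n * (q - 1)" "3 * (\<Sum>t<n. \<beta> w t) > n * (q - 1)"
          "3 * (\<Sum>t<n. \<gamma> w t) > n * (q - 1)" using mem by (auto simp: low_exps_def)
        then show False using sum by linarith
      qed
    qed
    show "T x x x \<noteq> 0" for x
    proof -
      have "a * x t + b * x t + c * x t = 0" for t using bal by (metis distrib_right mult_zero_left)
      then show ?thesis by (simp add: T_def)
    qed
    show "T x y z = 0" if "x \<in> S" "y \<in> S" "z \<in> S" "x \<noteq> y \<or> y \<noteq> z" for x y z
      using T0[OF that(1-3)] avoid[OF that(1-3)] merge[of x y z] that(4) by blast
  qed
  then show ?thesis by (simp add: q_def)
qed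

lemma three_variables_unavoidable:
  fixes a b c :: "'a::{field,finite}"
  assumes "a \<noteq> 0" "b \<noteq> 0" "c \<noteq> 0" "a + b + c = 0"
  shows "unavoidable (\<lambda>n S. \<exists>x\<in>S. \<exists>y\<in>S. \<exists>z\<in>S. x \<noteq> y \<and> y \<noteq> z \<and> x \<noteq> z \<and>
    (\<forall>t. a * x t + b * y t + c * z t = 0))"
proof -
  obtain \<gamma> where \<gamma>: "\<gamma> > 0" "\<gamma> < real (card (UNIV :: 'a set))"
    "\<And>n. real (card (low_exps (card (UNIV :: 'a set)) n)) \<le> \<gamma> ^ n"
    using card_low_exps[OF card_field_ge_2[where 'a='a]] by blast
  have "\<exists>x\<in>S. \<exists>y\<in>S. \<exists>z\<in>S. x \<noteq> y \<and> y \<noteq> z \<and> x \<noteq> z \<and> (\<forall>t. a * x t + b * y t + c * z t = 0)"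
    if S: "S \<subseteq> vecs n" and large: "real (card S) \<ge> 4 * \<gamma> ^ n" for n S
  proof (rule ccontr)
    assume "\<not> ?thesis"
    then have "card S \<le> 3 * card (low_exps (card (UNIV :: 'a set)) n)"
      by (intro three_variables_card_bound[OF assms S]) blast
    then have "real (card S) \<le> 3 * real (card (low_exps (card (UNIV :: 'a set)) n))" by linarith
    also have "\<dots> \<le> 3 * \<gamma> ^ n" using \<gamma>(3) by simp
    also have "\<dots> < 4 * \<gamma> ^ n" using \<gamma>(1) by simp
    finally show False using large by simp
  qed
  then show ?thesis unfolding unavoidable_def using \<gamma>(1,2)
    by (intro exI[of _ 4] exI[of _ \<gamma>]) auto
qed

section \<open>Robust representations\<close>

definition represents ::
  "'b set \<Rightarrow> ('b \<Rightarrow> 'a::field) \<Rightarrow> (nat \<Rightarrow> 'a) set \<Rightarrow> (nat \<Rightarrow> 'a) \<Rightarrow> bool" where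
  "represents J c S b \<longleftrightarrow>
     (\<exists>y. y ` J \<subseteq> S \<and> inj_on y J \<and> (\<forall>t. (\<Sum>j\<in>J. c j * y j t) = b t))"

text \<open>\<open>U\<close> stands for points already in use elsewhere in a solution. The target is
  the contribution of the variables in \<open>J\<close> when they all equal \<open>x\<close>, so a
  robust point can be substituted for these variables first and split into distinct points
  afterwards.\<close>

definition robust ::
  "nat \<Rightarrow> 'b set \<Rightarrow> ('b \<Rightarrow> 'a::field) \<Rightarrow> (nat \<Rightarrow> 'a) set \<Rightarrow> (nat \<Rightarrow> 'a) \<Rightarrow> bool" where
  "robust N J c S x \<longleftrightarrow>
     (\<forall>U. finite U \<and> card U \<le> N \<longrightarrow> represents J c (S - U) (\<lambda>t. sum c J * x t))"

lemma inj_on_Un_disjoint_images: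
  "\<lbrakk>inj_on f A; inj_on f B; f ` A \<inter> f ` B = {}\<rbrakk> \<Longrightarrow> inj_on f (A \<union> B)"
  unfolding inj_on_Un by blast

text \<open>Read \<open>y \<in> f x\<close> as an arc from \<open>x\<close> to \<open>y\<close>. All
  outdegrees are at most \<open>N\<close>, so by double counting some vertex also has indegree at
  most \<open>N\<close>. Choose this vertex, delete it together with its neighbours, at most
  \<open>2 * N + 1\<close> vertices in all, and recurse.\<close>

lemma independent_subset:
  assumes "finite V" "\<And>x. x \<in> V \<Longrightarrow> finite (f x) \<and> card (f x) \<le> N"
  shows "\<exists>I\<subseteq>V. card V \<le> (2 * N + 1) * card I \<and> (\<forall>x\<in>I. \<forall>y\<in>I. x \<noteq> y \<longrightarrow> y \<notin> f x)"
  using assms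
proof (induction "card V" arbitrary: V rule: less_induct)
  case less
  show ?case
  proof (cases "V = {}")
    case True
    then show ?thesis by auto
  next
    case False
    have "\<exists>y\<in>V. card {x \<in> V. y \<in> f x} \<le> N"
    proof (rule ccontr)
      assume "\<not> ?thesis"
      then have "(\<Sum>y\<in>V. N) < (\<Sum>y\<in>V. card {x \<in> V. y \<in> f x})"
        using False less.prems by (intro sum_strict_mono) auto
      also have "\<dots> = (\<Sum>x\<in>V. card {y \<in> V. y \<in> f x})"
        unfolding card_eq_sum using less.prems by (intro sum.swap_restrict)
      also have "\<dots> \<le> (\<Sum>x\<in>V. N)"
      proof (rule sum_mono)
        fix x assume "x \<in> V"
        then have "finite (f x)" "card (f x) \<le> N" using less.prems by auto
        moreover from this have "card {y \<in> V. y \<in> f x} \<le> card (f x)" by (intro card_mono) auto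
        ultimately show "card {y \<in> V. y \<in> f x} \<le> N" by linarith
      qed
      finally show False by simp
    qed
    then obtain y where y: "y \<in> V" "card {x \<in> V. y \<in> f x} \<le> N" by blast
    define D where "D = insert y (f y \<union> {x \<in> V. y \<in> f x})"
    have fD: "finite D" using y less.prems by (auto simp: D_def)
    have "card D \<le> 2 * N + 1"
    proof -
      have "card D \<le> Suc (card (f y \<union> {x \<in> V. y \<in> f x}))" unfolding D_def by (rule card_insert_le_m1) auto
      also have "card (f y \<union> {x \<in> V. y \<in> f x}) \<le> card (f y) + card {x \<in> V. y \<in> f x}" by (rule card_Un_le)
      finally show ?thesis using y less.prems(2)[OF y(1)] by simp
    qed
    moreover have "card (V - D) < card V"
      using y less.prems by (intro psubset_card_mono) (auto simp: D_def)
    then obtain I where I: "I \<subseteq> V - D" "card (V - D) \<le> (2 * N + 1) * card I"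
      "\<forall>x\<in>I. \<forall>y\<in>I. x \<noteq> y \<longrightarrow> y \<notin> f x"
      using less.hyps[of "V - D"] less.prems by blast
    moreover have "card V \<le> card (V - D) + card D"
      using less.prems fD by (metis card_Un_le Un_Diff_cancel2 Un_upper1 card_mono finite_Un order_trans)
    moreover have "card (insert y I) = Suc (card I)"
      using I finite_subset[OF I(1)] less.prems by (subst card_insert_disjoint) (auto simp: D_def)
    ultimately have "card V \<le> (2 * N + 1) * card (insert y I)" by simp
    moreover have "insert y I \<subseteq> V" using I y by auto
    moreover have "\<forall>x\<in>insert y I. \<forall>z\<in>insert y I. x \<noteq> z \<longrightarrow> z \<notin> f x"
      using I by (auto simp: D_def)
    ultimately show ?thesis by blast
  qed
qed

text \<open>If there were many nonrobust points, each with a blocking set \<open>U x\<close>, a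
  constant fraction of them would lie in no blocking set of another one. These contain a solution of
  the equation with the extra variable \<open>i\<close>. It represents the multiple of
  \<open>y i\<close> by other points of the family, which avoid \<open>U (y i)\<close>, contrary to
  the choice of this set.\<close>

lemma few_nonrobust_points:
  fixes c :: "nat \<Rightarrow> 'a::{field,finite}"
  assumes "finite M" "i \<notin> M"
    and "unavoidable (\<lambda>n S. represents (insert i M) (c(i := - sum c M)) S (\<lambda>_. 0))"
  shows "unavoidable (\<lambda>n S. k * card {x \<in> S. \<not> robust N M c S x} \<le> card S)"
proof (rule unavoidable_mono[OF unavoidable_dense_subset[OF assms(3), of "k * (2 * N + 1)"]])
  fix n :: nat and S :: "(nat \<Rightarrow> 'a) set"
  assume S: "S \<subseteq> vecs n" and H: "\<forall>T\<subseteq>S. card S \<le> k * (2 * N + 1) * card T \<longrightarrow>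
    represents (insert i M) (c(i := - sum c M)) T (\<lambda>_. 0)"
  define B where "B = {x \<in> S. \<not> robust N M c S x}"
  show "k * card {x \<in> S. \<not> robust N M c S x} \<le> card S"
  proof (rule ccontr)
    assume "\<not> ?thesis"
    then have large: "card S \<le> k * card B" by (simp add: B_def)
    have "\<forall>x\<in>B. \<exists>U. finite U \<and> card U \<le> N \<and> \<not> represents M c (S - U) (\<lambda>t. sum c M * x t)"
      by (auto simp: B_def robust_def)
    then obtain U where U: "\<And>x. x \<in> B \<Longrightarrow> finite (U x) \<and> card (U x) \<le> N"
      "\<And>x. x \<in> B \<Longrightarrow> \<not> represents M c (S - U x) (\<lambda>t. sum c M * x t)" by metis
    have "finite B" using finite_subset_vecs[OF S] by (simp add: B_def)
    then obtain I where I: "I \<subseteq> B" "card B \<le> (2 * N + 1) * card I"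
      "\<forall>x\<in>I. \<forall>y\<in>I. x \<noteq> y \<longrightarrow> y \<notin> U x"
      using independent_subset[of B U N] U(1) by blast
    \<comment> \<open>The factor \<open>k\<close> is lost in passing from \<open>S\<close> to the
      nonrobust points, the factor \<open>2 * N + 1\<close> in making them independent.\<close>
    have "card S \<le> k * ((2 * N + 1) * card I)" using large I(2) by (meson mult_le_mono2 order_trans)
    then have "card S \<le> k * (2 * N + 1) * card I" by (simp only: mult.assoc)
    moreover have "I \<subseteq> S" using I(1) by (auto simp: B_def)
    ultimately have "represents (insert i M) (c(i := - sum c M)) I (\<lambda>_. 0)"
      using H by blast
    then obtain y where y: "y ` insert i M \<subseteq> I" "inj_on y (insert i M)"
      "\<And>t. (\<Sum>j\<in>insert i M. (c(i := - sum c M)) j * y j t) = 0"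
      unfolding represents_def by blast
    have "(\<Sum>j\<in>M. c j * y j t) = sum c M * y i t" for t
    proof -
      have "(\<Sum>j\<in>M. (c(i := - sum c M)) j * y j t) = (\<Sum>j\<in>M. c j * y j t)"
        using assms(2) by (intro sum.cong) auto
      then show ?thesis using y(3)[of t] assms(1,2) by simp
    qed
    moreover have "y ` M \<subseteq> S - U (y i)"
    proof
      fix z assume "z \<in> y ` M"
      then obtain j where j: "j \<in> M" "z = y j" by blast
      then have "z \<noteq> y i" using y(2) assms(2) by (auto simp: inj_on_def)
      moreover have "z \<in> I" "y i \<in> I" using y(1) j by auto
      ultimately show "z \<in> S - U (y i)" using I by (auto simp: B_def)
    qed
    moreover have "inj_on y M" using y(2) by (auto simp: inj_on_def)
    ultimately have "represents M c (S - U (y i)) (\<lambda>t. sum c M * y i t)"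
      unfolding represents_def by blast
    then show False using U(2)[of "y i"] y(1) I(1) by auto
  qed
qed

text \<open>Here the target is 0 whatever \<open>x\<close> is. Once \<open>S\<close> has at least
  \<open>2 * N\<close> points, \<open>S - U\<close> keeps half of it and still contains a solution,
  so every point is robust.\<close>

lemma few_nonrobust_points_sum_zero:
  fixes c :: "nat \<Rightarrow> 'a::{field,finite}"
  assumes "sum c M = 0" and "unavoidable (\<lambda>n S. represents M c S (\<lambda>_. 0))"
  shows "unavoidable (\<lambda>n S. k * card {x \<in> S. \<not> robust N M c S x} \<le> card S)"
proof (rule unavoidable_mono[OF unavoidable_conj[OF unavoidable_dense_subset[OF assms(2), of 2]
        unavoidable_card_ge[of "2 * N"]]])
  fix n :: nat and S :: "(nat \<Rightarrow> 'a) set"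
  assume S: "S \<subseteq> vecs n" and H: "(\<forall>T\<subseteq>S. card S \<le> 2 * card T \<longrightarrow> represents M c T (\<lambda>_. 0)) \<and> 2 * N \<le> card S"
  have "robust N M c S x" for x
    unfolding robust_def
  proof (intro allI impI)
    fix U :: "(nat \<Rightarrow> 'a) set" assume "finite U \<and> card U \<le> N"
    then have "card S \<le> card (S - U) + N" using diff_card_le_card_Diff[of U S] by linarith
    then have "card S \<le> 2 * card (S - U)" using H by linarith
    then show "represents M c (S - U) (\<lambda>t. sum c M * x t)" using H assms(1) by simp
  qed
  then show "k * card {x \<in> S. \<not> robust N M c S x} \<le> card S" by simp
qed

text \<open>The variables in \<open>M\<close> are merged into one variable \<open>i\<close> with
  coefficient \<open>sum c M\<close>. The merged equation is solved inside the robust points, which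
  are at least half of \<open>S\<close>; then the value \<open>y i\<close> is split into distinct
  points of \<open>S\<close> that avoid the merged solution. The index \<open>k\<close> only labels
  the extra variable of the equation that makes most points robust.\<close>

lemma merge_variables:
  fixes c :: "nat \<Rightarrow> 'a::{field,finite}"
  assumes J: "finite J" "M \<subseteq> J" "i \<in> M" "k \<notin> M"
    and outer: "unavoidable (\<lambda>n S. represents (insert i (J - M)) (c(i := sum c M)) S (\<lambda>_. 0))"
    and inner: "unavoidable (\<lambda>n S. represents (insert k M) (c(k := - sum c M)) S (\<lambda>_. 0))"
  shows "unavoidable (\<lambda>n S. represents J c S (\<lambda>_. 0))"
proof (rule unavoidable_mono[OF unavoidable_conj[OF unavoidable_dense_subset[OF outer, of 2]
        few_nonrobust_points[OF _ J(4) inner, of 2 "card J"]]])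
  show "finite M" using J by (simp add: finite_subset)
next
  fix n :: nat and S :: "(nat \<Rightarrow> 'a) set"
  let ?J' = "insert i (J - M)"
  assume S: "S \<subseteq> vecs n"
    and H: "(\<forall>T\<subseteq>S. card S \<le> 2 * card T \<longrightarrow> represents ?J' (c(i := sum c M)) T (\<lambda>_. 0)) \<and>
      2 * card {x \<in> S. \<not> robust (card J) M c S x} \<le> card S"
  define G where "G = {x \<in> S. robust (card J) M c S x}"
  have finS: "finite S" using S by (rule finite_subset_vecs)
  have "card S = card G + card {x \<in> S. \<not> robust (card J) M c S x}"
    unfolding G_def using finS by (subst card_Un_disjoint[symmetric]) (auto intro!: arg_cong[of _ _ card])
  then have "card S \<le> 2 * card G" using H by linarith
  moreover have "G \<subseteq> S" by (auto simp: G_def)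
  ultimately obtain y where y: "y ` ?J' \<subseteq> G" "inj_on y ?J'"
    "\<And>t. (\<Sum>j\<in>?J'. (c(i := sum c M)) j * y j t) = 0"
    using H unfolding represents_def by blast
  have "card (y ` ?J') \<le> card J"
    using J by (intro order_trans[OF card_image_le] card_mono) auto
  moreover have "finite (y ` ?J')" "robust (card J) M c S (y i)" using J y(1) by (auto simp: G_def)
  ultimately have "represents M c (S - y ` ?J') (\<lambda>t. sum c M * y i t)"
    unfolding robust_def by blast
  then obtain z where z: "z ` M \<subseteq> S - y ` ?J'" "inj_on z M"
    "\<And>t. (\<Sum>j\<in>M. c j * z j t) = sum c M * y i t"
    unfolding represents_def by blast
  define w where "w j = (if j \<in> M then z j else y j)" for j
  have "w ` J \<subseteq> S" using y(1) z(1) by (auto simp: w_def G_def)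
  moreover have "inj_on w J"
  proof -
    have "inj_on w M" using z(2) by (auto simp: w_def inj_on_def)
    moreover have "inj_on w (J - M)" using y(2) by (auto simp: w_def inj_on_def)
    moreover have "w ` M \<inter> w ` (J - M) = {}" using z(1) by (auto simp: w_def)
    ultimately have "inj_on w (M \<union> (J - M))" by (rule inj_on_Un_disjoint_images)
    then show ?thesis using J(2) by (simp add: Un_absorb1)
  qed
  moreover have "(\<Sum>j\<in>J. c j * w j t) = 0" for t
  proof -
    have "(\<Sum>j\<in>J. c j * w j t) = (\<Sum>j\<in>J - M. c j * w j t) + (\<Sum>j\<in>M. c j * w j t)"
      using J by (intro sum.subset_diff) auto
    also have "(\<Sum>j\<in>M. c j * w j t) = sum c M * y i t" by (simp add: w_def z(3))
    also have "(\<Sum>j\<in>J - M. c j * w j t) = (\<Sum>j\<in>J - M. (c(i := sum c M)) j * y j t)"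
      using J by (intro sum.cong) (auto simp: w_def)
    finally show ?thesis using y(3)[of t] J by (simp add: add.commute)
  qed
  ultimately show "represents J c S (\<lambda>_. 0)" unfolding represents_def by blast
qed

section \<open>Systems of differences\<close>

lemma disjoint_subsets:
  assumes "finite I" "finite S" "card I * s \<le> card S"
  shows "\<exists>P. (\<forall>D\<in>I. P D \<subseteq> S \<and> card (P D) = s) \<and> disjoint_family_on P I"
  using assms
proof (induction I)
  case empty
  show ?case by (auto simp: disjoint_family_on_def)
next
  case (insert E I)
  then have "card I * s \<le> card S" by simp
  with insert obtain P where P: "\<forall>D\<in>I. P D \<subseteq> S \<and> card (P D) = s" "disjoint_family_on P I" by auto
  have fin: "finite (\<Union>D\<in>I. P D)" using P insert by (auto intro: finite_subset)
  have "card (\<Union>D\<in>I. P D) \<le> (\<Sum>D\<in>I. card (P D))" using insert by (intro card_UN_le)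
  also have "\<dots> = card I * s" using P by simp
  finally have "s \<le> card (S - (\<Union>D\<in>I. P D))"
    using insert diff_card_le_card_Diff[OF fin, of S] by simp
  then obtain Q where Q: "Q \<subseteq> S - (\<Union>D\<in>I. P D)" "card Q = s" by (rule obtain_subset_with_card_n)
  have "disjoint_family_on (P(E := Q)) (insert E I)"
    using P Q insert.hyps by (auto simp: disjoint_family_on_def)
  moreover have "\<forall>D\<in>insert E I. (P(E := Q)) D \<subseteq> S \<and> card ((P(E := Q)) D) = s"
    using P Q by auto
  ultimately show ?case by blast
qed

text \<open>Let \<open>\<phi>\<close> be the linear map whose kernel is the solution space. By
  pigeonhole one fibre \<open>X\<close> of \<open>\<phi>\<close> on the product set \<open>Q\<close>
  has at least \<open>card Q / card F\<close> elements. Fix \<open>x\<close> in \<open>X\<close>.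
  The vector \<mu> provides solutions with any prescribed entry at \<open>C\<close>, so fixing the
  entry at \<open>C\<close> cuts the size of a fibre on \<open>W\<close>, which is
  \<open>card W / card F\<close>, by the factor \<open>card V\<close>. Hence the elements of
  \<open>X\<close> that agree with \<open>x\<close> at some \<open>C\<close> are too few to fill
  \<open>X\<close>.\<close>

lemma product_set_difference_solution:
  fixes v :: "'b \<Rightarrow> nat \<Rightarrow> 'a::{field,finite}"
  assumes I: "finite I" "I \<noteq> {}"
    and \<mu>: "\<And>C. C \<in> I \<Longrightarrow> \<exists>\<mu>. \<mu> C = 1 \<and> (\<forall>i<m. (\<Sum>D\<in>I. \<mu> D * v D i) = 0)"
    and P: "\<And>D. D \<in> I \<Longrightarrow> P D \<subseteq> vecs n"
    and large: "card I * (card (UNIV :: 'a set) ^ n) ^ (card I - 1) < (\<Prod>D\<in>I. card (P D))"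
  shows "\<exists>x x'. (\<forall>D\<in>I. x D \<in> P D \<and> x' D \<in> P D \<and> x D \<noteq> x' D) \<and>
    (\<forall>i<m. \<forall>t. (\<Sum>D\<in>I. v D i * (x D t - x' D t)) = 0)"
proof -
  define V :: "(nat \<Rightarrow> 'a) set" where "V = vecs n"
  define W where "W = PiE I (\<lambda>_. V)"
  \<comment> \<open>The value 0 for \<open>i \<ge> m\<close> makes two images equal as functions as
    soon as they agree on the \<open>m\<close> equations.\<close>
  define \<phi> where "\<phi> w = (\<lambda>i t. if i < m then \<Sum>D\<in>I. v D i * w D t else 0)" for w :: "'b \<Rightarrow> nat \<Rightarrow> 'a"
  define F where "F = \<phi> ` W"
  define Q where "Q = PiE I P"
  have finV: "finite V" and cardV: "card V = card (UNIV :: 'a set) ^ n" by (auto simp: V_def card_vecs)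
  have finW: "finite W" and cardW: "card W = card V ^ card I"
    using I finV by (auto simp: W_def card_PiE intro: finite_PiE)
  have QW: "Q \<subseteq> W" unfolding Q_def W_def V_def using P by (intro PiE_mono) auto
  have cardQ: "card Q = (\<Prod>D\<in>I. card (P D))" using I by (simp add: Q_def card_PiE)
  have finQ: "finite Q" using QW finW by (rule finite_subset)
  have finF: "finite F" using finW by (simp add: F_def)
  have "Q \<noteq> {}" using cardQ large by auto
  then have "F \<noteq> {}" using QW by (auto simp: F_def)
  then obtain f where f: "f \<in> F" "card Q \<le> card (\<phi> -` {f} \<inter> Q) * card F"
    using pigeonhole_card[of \<phi> Q F] QW finQ finF by (auto simp: F_def)
  define X where "X = \<phi> -` {f} \<inter> Q"
  have "card Q > 0" using cardQ large by linarith
  then have "card X > 0" using f(2) X_def by (metis mult_is_0 not_gr_zero le_zero_eq)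
  then obtain x where x: "x \<in> X" by (metis card_gt_0_iff ex_in_conv)
  have finX: "finite X" using finQ by (simp add: X_def)
  have "\<exists>x'\<in>X. \<forall>D\<in>I. x D \<noteq> x' D"
  proof (rule ccontr)
    assume "\<not> ?thesis"
    then have cover: "X \<subseteq> (\<Union>C\<in>I. {x' \<in> X. x' C = x C})" by force
    have bad: "card {x' \<in> X. x' C = x C} * (card V * card F) \<le> card W" if C: "C \<in> I" for C
    proof -
      obtain \<mu> where \<mu>: "\<mu> C = 1" "\<And>i. i < m \<Longrightarrow> (\<Sum>D\<in>I. \<mu> D * v D i) = 0" using assms(3)[OF C] by blast
      define r where "r = inv_into W \<phi>"
      have r: "r f' \<in> W" "\<phi> (r f') = f'" if "f' \<in> F" for f'
        using that by (auto simp: r_def F_def inv_into_into f_inv_into_f)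
      \<comment> \<open>An injection into \<open>W\<close> that proves the bound on a slice of the
        fibre. Both \<open>x' - x\<close> and the multiple of \<mu> lie in the kernel, so
        \<open>\<phi>\<close> returns \<open>f'\<close>. At \<open>C\<close> the difference vanishes
        and \<open>\<mu> C = 1\<close>, so this entry returns \<open>y\<close>, and then
        \<open>x'\<close> is determined.\<close>
      define g where "g = (\<lambda>(x', y, f'). restrict (\<lambda>D t. x' D t - x D t + \<mu> D * y t + r f' D t) I)"
      have \<phi>g: "\<phi> (g (x', y, f')) = f'" if "x' \<in> X" "f' \<in> F" for x' y f'
      proof (intro ext)
        fix i t
        show "\<phi> (g (x', y, f')) i t = f' i t"
        proof (cases "i < m")
          case True
          have "(\<Sum>D\<in>I. v D i * g (x', y, f') D t) =
              (\<Sum>D\<in>I. v D i * x' D t) - (\<Sum>D\<in>I. v D i * x D t) + (\<Sum>D\<in>I. \<mu> D * v D i) * y t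
              + (\<Sum>D\<in>I. v D i * r f' D t)"
            by (simp add: g_def sum.distrib sum_subtractf algebra_simps sum_distrib_left)
          also have "(\<Sum>D\<in>I. v D i * x' D t) = (\<Sum>D\<in>I. v D i * x D t)"
          proof -
            have "\<phi> x' = \<phi> x" using that x by (simp add: X_def)
            then have "\<phi> x' i t = \<phi> x i t" by simp
            then show ?thesis using True by (simp add: \<phi>_def)
          qed
          also have "(\<Sum>D\<in>I. v D i * r f' D t) = f' i t"
            using fun_cong[OF fun_cong[OF r(2)[OF that(2)]], of i t] True by (simp add: \<phi>_def)
          finally show ?thesis using True \<mu>(2) by (simp add: \<phi>_def)
        next
          case False
          then have "f' i t = 0"
            using fun_cong[OF fun_cong[OF r(2)[OF that(2)]], of i t] by (simp add: \<phi>_def)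
          then show ?thesis using False by (simp add: \<phi>_def)
        qed
      qed
      have "inj_on g ({x' \<in> X. x' C = x C} \<times> V \<times> F)"
      proof (rule inj_onI)
        fix p p' assume p: "p \<in> {x' \<in> X. x' C = x C} \<times> V \<times> F" "p' \<in> {x' \<in> X. x' C = x C} \<times> V \<times> F"
          and "g p = g p'"
        obtain x1 y1 f1 x2 y2 f2 where pp: "p = (x1, y1, f1)" "p' = (x2, y2, f2)"
          by (metis surj_pair)
        have 1: "x1 \<in> X" "x1 C = x C" "y1 \<in> V" "f1 \<in> F" and 2: "x2 \<in> X" "x2 C = x C" "y2 \<in> V" "f2 \<in> F"
          and eq: "g (x1, y1, f1) = g (x2, y2, f2)"
          using p \<open>g p = g p'\<close> by (auto simp: pp)
        have f: "f1 = f2" using \<phi>g[OF 1(1,4), of y1] \<phi>g[OF 2(1,4), of y2] eq by simp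
        have eqD: "x1 D t - x D t + \<mu> D * y1 t = x2 D t - x D t + \<mu> D * y2 t" if "D \<in> I" for D t
          using fun_cong[OF fun_cong[OF eq], of D t] that f by (simp add: g_def)
        have y: "y1 = y2"
        proof
          fix t show "y1 t = y2 t" using eqD[OF C, of t] 1(2) 2(2) \<mu>(1) by simp
        qed
        have "x1 D = x2 D" if "D \<in> I" for D
        proof
          fix t show "x1 D t = x2 D t" using eqD[OF that, of t] y by simp
        qed
        then have "x1 = x2" using 1(1) 2(1) by (intro PiE_ext[of _ I P]) (auto simp: X_def Q_def)
        then show "p = p'" using y f by (simp add: pp)
      qed
      moreover have "g ` ({x' \<in> X. x' C = x C} \<times> V \<times> F) \<subseteq> W"
      proof clarify
        fix x' y f' assume 1: "x' \<in> X" "y \<in> V" "f' \<in> F"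
        have "x' \<in> W" "x \<in> W" "r f' \<in> W" using 1 x QW r by (auto simp: X_def)
        then have "x' D t = 0" "x D t = 0" "r f' D t = 0" "y t = 0" if "D \<in> I" "n \<le> t" for D t
          using that 1(2) by (auto simp: W_def V_def vecs_def PiE_iff)
        then show "g (x', y, f') \<in> W" by (auto simp: W_def V_def vecs_def g_def)
      qed
      ultimately have "card ({x' \<in> X. x' C = x C} \<times> V \<times> F) \<le> card W"
        using finW by (rule card_inj_on_le)
      then show ?thesis by (simp add: card_cartesian_product)
    qed
    have "card Q * card V \<le> card X * (card V * card F)"
      using f(2) by (simp add: X_def mult_ac mult_le_mono2)
    also have "card X \<le> (\<Sum>C\<in>I. card {x' \<in> X. x' C = x C})"
      using order_trans[OF card_mono[OF _ cover] card_UN_le[OF I(1)]] finX I by simp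
    also have "(\<Sum>C\<in>I. card {x' \<in> X. x' C = x C}) * (card V * card F) \<le> card I * card W"
      unfolding sum_distrib_right using sum_mono[of I _ "\<lambda>_. card W", OF bad] by simp
    finally have "card Q * card V \<le> card I * card V ^ (card I - 1) * card V"
      using I cardW by (cases "card I") (auto simp: mult_ac)
    moreover have "card V > 0" using card_field_ge_2[where 'a='a] by (simp add: cardV)
    ultimately show False using large cardQ cardV by auto
  qed
  then obtain x' where x': "x' \<in> X" "\<forall>D\<in>I. x D \<noteq> x' D" by blast
  have "(\<Sum>D\<in>I. v D i * (x D t - x' D t)) = 0" if "i < m" for i t
  proof -
    have "\<phi> x i t = \<phi> x' i t" using x x' by (simp add: X_def)
    then show ?thesis using that by (simp add: \<phi>_def right_diff_distrib sum_subtractf)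
  qed
  then show ?thesis using x x' by (intro exI[of _ x] exI[of _ x']) (auto simp: X_def Q_def)
qed

definition separated_pairs :: "'b set \<Rightarrow> 'c set \<Rightarrow> ('b \<Rightarrow> 'c) \<Rightarrow> ('b \<Rightarrow> 'c) \<Rightarrow> bool" where
  "separated_pairs I S x x' \<longleftrightarrow> x ` I \<subseteq> S \<and> x' ` I \<subseteq> S \<and> inj_on x I \<and> inj_on x' I \<and> x ` I \<inter> x' ` I = {}"

text \<open>Cut \<open>S\<close> into \<open>card I\<close> disjoint parts of equal size and look
  for the pair with index \<open>D\<close> in the part \<open>P D\<close>. Entries with different
  indices are then distinct automatically, and the preceding lemma makes the two entries with the
  same index distinct.\<close>

lemma difference_system_unavoidable:
  fixes v :: "'b \<Rightarrow> nat \<Rightarrow> 'a::{field,finite}"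
  assumes I: "finite I" "I \<noteq> {}"
    and \<mu>: "\<And>C. C \<in> I \<Longrightarrow> \<exists>\<mu>. \<mu> C = 1 \<and> (\<forall>i<m. (\<Sum>D\<in>I. \<mu> D * v D i) = 0)"
  shows "unavoidable (\<lambda>n S. \<exists>x x'. separated_pairs I S x x' \<and>
    (\<forall>i<m. \<forall>t. (\<Sum>D\<in>I. v D i * (x D t - x' D t)) = 0))"
proof -
  define q where "q = card (UNIV :: 'a set)"
  have q: "q \<ge> 2" using card_field_ge_2[where 'a='a] by (simp add: q_def)
  define l where "l = card I"
  have l: "l \<ge> 1" using I by (simp add: l_def Suc_leI card_gt_0_iff)
  \<comment> \<open>With \<open>s\<close> points in each of \<open>l\<close> parts, the product set
    has to exceed \<open>l * q ^ (n * (l - 1))\<close>. So the critical base for \<open>s\<close> is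
    \<open>q\<close> to the power \<open>(l - 1) / l\<close>, which is less than
    \<open>q\<close>.\<close>
  define \<gamma> where "\<gamma> = root l (real q ^ (l - 1))"
  have \<gamma>l: "\<gamma> ^ l = real q ^ (l - 1)" unfolding \<gamma>_def using l by (intro real_root_pow_pos2) auto
  have \<gamma>1: "\<gamma> \<ge> 1" unfolding \<gamma>_def using l q by (subst real_root_ge_1_iff) auto
  have "\<gamma> ^ l < real q ^ l" unfolding \<gamma>l using l q by (intro power_strict_increasing) auto
  then have \<gamma>q: "\<gamma> < real q" using power_less_imp_less_base[of \<gamma> l "real q"] by simp
  have "\<exists>x x'. separated_pairs I S x x' \<and>
      (\<forall>i<m. \<forall>t. (\<Sum>D\<in>I. v D i * (x D t - x' D t)) = 0)"
    if S: "S \<subseteq> vecs n" and large: "real (card S) \<ge> 2 * real l * (real l + 1) * \<gamma> ^ n" for n S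
  proof -
    \<comment> \<open>In the lower bound for \<open>card S\<close>, the factor \<open>l\<close> pays
      for the division into parts, the factor 2 for rounding down, and \<open>l + 1\<close> for
      making the final inequality strict.\<close>
    define s where "s = card S div l"
    obtain P where P: "\<forall>D\<in>I. P D \<subseteq> S \<and> card (P D) = s" "disjoint_family_on P I"
      using disjoint_subsets[OF I(1) finite_subset_vecs[OF S], of s] by (auto simp: s_def l_def)
    have \<gamma>n: "\<gamma> ^ n \<ge> 1" using \<gamma>1 by simp
    have "(real l + 1) * \<gamma> ^ n \<le> real s"
    proof -
      have "card S < l * (s + 1)" using l by (simp add: s_def dividend_less_times_div)
      then have "real (card S) < real l * (real s + 1)"
        by (metis of_nat_1 of_nat_add of_nat_less_iff of_nat_mult)
      then have "real l * (2 * (real l + 1) * \<gamma> ^ n) < real l * (real s + 1)"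
        using large by (simp add: mult_ac)
      then have "2 * (real l + 1) * \<gamma> ^ n < real s + 1" using l by simp
      moreover have "1 \<le> (real l + 1) * \<gamma> ^ n" using \<gamma>n l mult_mono[of 1 "real l + 1" 1 "\<gamma> ^ n"] by simp
      ultimately show ?thesis by linarith
    qed
    then have "((real l + 1) * \<gamma> ^ n) ^ l \<le> real s ^ l" using \<gamma>1 by (intro power_mono) auto
    moreover have "((real l + 1) * \<gamma> ^ n) ^ l = (real l + 1) ^ l * (real q ^ n) ^ (l - 1)"
      by (simp add: power_mult_distrib power_mult[symmetric] mult.commute[of n] power_mult[of \<gamma> l n] \<gamma>l)
    moreover have "real l * (real q ^ n) ^ (l - 1) < (real l + 1) ^ l * (real q ^ n) ^ (l - 1)"
    proof -
      have "real l + 1 \<le> (real l + 1) ^ l" using l by (intro self_le_power) auto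
      then show ?thesis using q by (intro mult_strict_right_mono) auto
    qed
    ultimately have "real (l * (q ^ n) ^ (l - 1)) < real (s ^ l)" by simp
    then have "l * (q ^ n) ^ (l - 1) < s ^ l" by linarith
    moreover have "(\<Prod>D\<in>I. card (P D)) = s ^ l" using P by (simp add: l_def)
    moreover have "P D \<subseteq> vecs n" if "D \<in> I" for D using P S that by blast
    ultimately obtain x x' where x: "\<forall>D\<in>I. x D \<in> P D \<and> x' D \<in> P D \<and> x D \<noteq> x' D"
      "\<forall>i<m. \<forall>t. (\<Sum>D\<in>I. v D i * (x D t - x' D t)) = 0"
      using product_set_difference_solution[OF I \<mu>, of P n] by (auto simp: l_def q_def)
    have sep: "D = E" if "D \<in> I" "E \<in> I" "z \<in> P D" "z \<in> P E" for D E z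
      using P(2) that by (auto simp: disjoint_family_on_def)
    have "inj_on x I" "inj_on x' I" using x(1) sep by (metis inj_onI)+
    moreover have "x ` I \<inter> x' ` I = {}"
    proof -
      have "x D \<noteq> x' E" if "D \<in> I" "E \<in> I" for D E using x(1) sep that by metis
      then show ?thesis by auto
    qed
    moreover have "x ` I \<subseteq> S" "x' ` I \<subseteq> S" using x(1) P(1) by auto
    ultimately have "separated_pairs I S x x'" by (simp add: separated_pairs_def)
    then show ?thesis using x(2) by blast
  qed
  then show ?thesis unfolding unavoidable_def using \<gamma>1 \<gamma>q l
    by (intro exI[of _ "2 * real l * (real l + 1)"] exI[of _ \<gamma>]) (auto simp: q_def)
qed

section \<open>A single balanced equation\<close>

lemma single_equation_three:
  fixes c :: "nat \<Rightarrow> 'a::{field,finite}"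
  assumes "card J = 3" "\<And>j. j \<in> J \<Longrightarrow> c j \<noteq> 0" "sum c J = 0"
  shows "unavoidable (\<lambda>n S. represents J c S (\<lambda>_. 0))"
proof -
  obtain i j k where J: "J = {i, j, k}" "i \<noteq> j" "j \<noteq> k" "i \<noteq> k"
    using assms(1) unfolding card_3_iff by blast
  have "c i + c j + c k = 0" using assms(3) J by (simp add: add.assoc)
  then have 3: "unavoidable (\<lambda>n S. \<exists>x\<in>S. \<exists>y\<in>S. \<exists>z\<in>S. x \<noteq> y \<and> y \<noteq> z \<and> x \<noteq> z \<and>
    (\<forall>t. c i * x t + c j * y t + c k * z t = 0))"
    using assms(2) J by (intro three_variables_unavoidable) auto
  show ?thesis
  proof (rule unavoidable_mono[OF 3])
    fix n :: nat and S :: "(nat \<Rightarrow> 'a) set"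
    assume "\<exists>x\<in>S. \<exists>y\<in>S. \<exists>z\<in>S. x \<noteq> y \<and> y \<noteq> z \<and> x \<noteq> z \<and> (\<forall>t. c i * x t + c j * y t + c k * z t = 0)"
    then obtain x y z where xyz: "x \<in> S" "y \<in> S" "z \<in> S" "x \<noteq> y" "y \<noteq> z" "x \<noteq> z"
      "\<And>t. c i * x t + c j * y t + c k * z t = 0" by blast
    define w where "w = (\<lambda>_. z)(i := x, j := y)"
    have w: "w i = x" "w j = y" "w k = z" using J by (auto simp: w_def)
    have "w ` J \<subseteq> S" "inj_on w J" using J w xyz by (auto simp: inj_on_def)
    moreover have "(\<Sum>j\<in>J. c j * w j t) = 0" for t using J w xyz(7)[of t] by (simp add: add.assoc)
    ultimately show "represents J c S (\<lambda>_. 0)" unfolding represents_def by blast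
  qed
qed

text \<open>Such an equation says that a multiple of one difference plus a multiple of another
  difference is zero, so it is a difference system with a single row. This is the case that merging
  cannot reach.\<close>

lemma single_equation_two_pairs:
  fixes c :: "nat \<Rightarrow> 'a::{field,finite}"
  assumes "distinct [i, j, k, l]" "c i \<noteq> 0" "c k \<noteq> 0" "c i + c j = 0" "c k + c l = 0"
  shows "unavoidable (\<lambda>n S. represents {i, j, k, l} c S (\<lambda>_. 0))"
proof (rule unavoidable_mono[OF difference_system_unavoidable[of "{i, k}" 1 "\<lambda>D _. c D"]])
  \<comment> \<open>The weight of the index other than \<open>C\<close> is chosen to cancel the
    coefficient at \<open>C\<close>.\<close>
  show "\<exists>\<mu>. \<mu> C = 1 \<and> (\<forall>h<(1::nat). (\<Sum>D\<in>{i, k}. \<mu> D * c D) = 0)" if "C \<in> {i, k}" for C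
    using assms that by (intro exI[of _ "\<lambda>D. if D = C then 1 else - c C / c D"]) auto
next
  fix n :: nat and S :: "(nat \<Rightarrow> 'a) set"
  assume "\<exists>x x'. separated_pairs {i, k} S x x' \<and>
    (\<forall>h<(1::nat). \<forall>t. (\<Sum>D\<in>{i, k}. c D * (x D t - x' D t)) = 0)"
  then obtain x x' where sep: "separated_pairs {i, k} S x x'"
    and sol: "\<forall>h<(1::nat). \<forall>t. (\<Sum>D\<in>{i, k}. c D * (x D t - x' D t)) = 0" by blast
  have x: "x i \<in> S" "x k \<in> S" "x' i \<in> S" "x' k \<in> S"
    "distinct [x i, x' i, x k, x' k]"
    using sep assms(1) by (auto simp: separated_pairs_def)
  define w where "w = x(j := x' i, l := x' k)"
  have w: "w i = x i" "w j = x' i" "w k = x k" "w l = x' k" using assms by (auto simp: w_def)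
  have "w ` {i, j, k, l} \<subseteq> S" using w x by auto
  moreover have "inj_on w {i, j, k, l}" using w x assms by (auto simp: inj_on_def)
  moreover have "(\<Sum>h\<in>{i, j, k, l}. c h * w h t) = 0" for t
  proof -
    have "c j = - c i" "c l = - c k" using assms by (simp_all add: eq_neg_iff_add_eq_0 add.commute)
    moreover have "c i * (x i t - x' i t) + c k * (x k t - x' k t) = 0" using sol assms by auto
    ultimately show ?thesis using assms(1) w by (simp add: algebra_simps)
  qed
  ultimately show "represents {i, j, k, l} c S (\<lambda>_. 0)" unfolding represents_def by blast
qed auto

text \<open>Induction on the number of variables by merging a set \<open>M\<close> of two or three
  variables with nonzero coefficient sum. The bounds on \<open>card M\<close> ensure that the merged
  equation and the equation for splitting have at least three variables each and are shorter than
  the given one. A pair with nonzero sum works from four variables on. If the pair cancels, then for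
  five or more variables a third one makes the sum nonzero, and for four variables the other two
  cancel as well.\<close>

lemma single_equation_unavoidable:
  fixes c :: "nat \<Rightarrow> 'a::{field,finite}"
  assumes "finite J" "card J \<ge> 3" "\<And>j. j \<in> J \<Longrightarrow> c j \<noteq> 0" "sum c J = 0"
  shows "unavoidable (\<lambda>n S. represents J c S (\<lambda>_. 0))"
  using assms
proof (induction "card J" arbitrary: J c rule: less_induct)
  case less
  have merge: ?case if M: "M \<subseteq> J" "2 \<le> card M" "card M \<le> 3" "card M + 2 \<le> card J" "card M + 1 < card J"
    "sum c M \<noteq> 0" for M
  proof -
    have fM: "finite M" using M(1) less.prems(1) by (rule finite_subset)
    obtain i where i: "i \<in> M" using M(2) fM by (metis card.empty ex_in_conv not_numeral_le_zero)
    obtain k where k: "k \<notin> M" using ex_new_if_finite[OF infinite_UNIV_nat fM] by blast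
    have cJM: "card (J - M) = card J - card M" using fM M(1) by (rule card_Diff_subset)
    show ?thesis
    proof (rule merge_variables[OF less.prems(1) M(1) i k])
      show "unavoidable (\<lambda>n S. represents (insert i (J - M)) (c(i := sum c M)) S (\<lambda>_. 0))"
      proof (rule less.hyps)
        show "card (insert i (J - M)) < card J" "3 \<le> card (insert i (J - M))"
          using less.prems(1) i cJM M by (auto simp: card_insert_if)
        have "sum (c(i := sum c M)) (J - M) = sum c (J - M)" using i by (intro sum.cong) auto
        then show "sum (c(i := sum c M)) (insert i (J - M)) = 0"
          using less.prems i M(1) sum.subset_diff[OF M(1), of c] by (simp add: add.commute)
      qed (use less.prems M in auto)
      show "unavoidable (\<lambda>n S. represents (insert k M) (c(k := - sum c M)) S (\<lambda>_. 0))"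
      proof (rule less.hyps)
        show "card (insert k M) < card J" "3 \<le> card (insert k M)" using fM k M by auto
        have "sum (c(k := - sum c M)) M = sum c M" using k by (intro sum.cong) auto
        then show "sum (c(k := - sum c M)) (insert k M) = 0" using fM k by simp
      qed (use less.prems fM M in auto)
    qed
  qed
  obtain i j k where ijk: "{i, j, k} \<subseteq> J" "i \<noteq> j" "j \<noteq> k" "i \<noteq> k"
    using obtain_subset_with_card_n[OF less.prems(2)] unfolding card_3_iff by metis
  have c3: "card {i, j, k} = 3" using ijk by simp
  consider "card J = 3" | "card J = 4" | "card J \<ge> 5" using less.prems(2) by linarith
  then show ?case
  proof cases
    case 1
    then show ?thesis using less.prems by (intro single_equation_three) auto
  next
    case 2
    show ?thesis
    proof (cases "c i + c j = 0")
      case False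
      then show ?thesis using ijk 2 by (intro merge[of "{i, j}"]) auto
    next
      case True
      have "card (J - {i, j, k}) = 1" using 2 c3 card_Diff_subset[of "{i, j, k}" J] ijk by simp
      then obtain l where l: "J - {i, j, k} = {l}" by (rule card_1_singletonE)
      then have J: "J = {i, j, k, l}" "distinct [i, j, k, l]" using ijk by auto
      then have "c i + c j + (c k + c l) = 0" using less.prems(4) by (simp add: add.assoc)
      then have "c k + c l = 0" using True by simp
      then show ?thesis using J True less.prems(3) single_equation_two_pairs[of i j k l c] by auto
    qed
  next
    case 3
    show ?thesis
    proof (cases "c i + c j = 0")
      case False
      then show ?thesis using ijk 3 by (intro merge[of "{i, j}"]) auto
    next
      case True
      \<comment> \<open>The pair contributes nothing, so the triple inherits the nonzero coefficient
        of its third variable.\<close>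
      then have eq: "sum c {i, j, k} = c k" using ijk by (simp add: add.assoc[symmetric])
      have "sum c {i, j, k} \<noteq> 0" unfolding eq using ijk less.prems(3) by simp
      then show ?thesis using ijk(1) 3 c3 by (intro merge[of "{i, j, k}"]) linarith+
    qed
  qed
qed

text \<open>If the coefficients sum to zero, there are at least three of them and the equation on
  \<open>M\<close> itself is available. Otherwise a new variable with coefficient
  \<open>- sum c M\<close> balances the equation and raises the number of variables to at least
  three.\<close>

lemma few_nonrobust_points_class:
  fixes c :: "nat \<Rightarrow> 'a::{field,finite}"
  assumes "finite M" "card M \<ge> 2" "\<And>j. j \<in> M \<Longrightarrow> c j \<noteq> 0" "card M = 2 \<Longrightarrow> sum c M \<noteq> 0"
  shows "unavoidable (\<lambda>n S. k * card {x \<in> S. \<not> robust N M c S x} \<le> card S)"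
proof (cases "sum c M = 0")
  case True
  then have "card M \<ge> 3" using assms by linarith
  then show ?thesis using assms True
    by (intro few_nonrobust_points_sum_zero single_equation_unavoidable) auto
next
  case False
  obtain i where i: "i \<notin> M" using ex_new_if_finite[OF infinite_UNIV_nat assms(1)] by blast
  have "sum (c(i := - sum c M)) M = sum c M" using i by (intro sum.cong) auto
  then have "unavoidable (\<lambda>n S. represents (insert i M) (c(i := - sum c M)) S (\<lambda>_. 0))"
    using assms False i by (intro single_equation_unavoidable) auto
  then show ?thesis using assms(1) i by (intro few_nonrobust_points)
qed

section \<open>Column equivalence classes\<close>

text \<open>Either \<open>w\<close> lies in the span of the vectors or a linear functional separates
  it from them. When a vector \<open>v C\<close> is added that already lies in the span, nothing
  changes. Otherwise a functional \<open>g\<close> separates \<open>v C\<close> from the old span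
  and serves to project \<open>v C\<close> out of both \<open>w\<close> and the functional found by
  induction.\<close>

lemma fredholm_alternative:
  fixes v :: "'b \<Rightarrow> nat \<Rightarrow> 'a::field"
  assumes "finite J"
  shows "(\<exists>\<mu>. \<forall>i<m. w i = (\<Sum>D\<in>J. \<mu> D * v D i)) \<or>
    (\<exists>f. (\<Sum>i<m. f i * w i) \<noteq> 0 \<and> (\<forall>D\<in>J. (\<Sum>i<m. f i * v D i) = 0))"
  using assms
proof (induction J arbitrary: w)
  case empty
  show ?case
  proof (cases "\<forall>i<m. w i = 0")
    case False
    then obtain i where i: "i < m" "w i \<noteq> 0" by blast
    have "(\<Sum>h<m. (if h = i then 1 else 0) * w h) = (\<Sum>h<m. if h = i then w h else 0)"
      by (intro sum.cong) auto
    also have "\<dots> \<noteq> 0" using i by simp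
    finally show ?thesis by (intro disjI2 exI[of _ "\<lambda>h. if h = i then 1 else 0"]) simp
  qed simp
next
  case (insert C J)
  let ?span = "\<lambda>J w. \<exists>\<mu>. \<forall>i<m. w i = (\<Sum>D\<in>J. \<mu> D * v D i)"
  have extend: "?span (insert C J) w" if reduced: "?span J (\<lambda>i. w i - a * v C i)" for w a
  proof -
    obtain \<mu> where \<mu>: "\<forall>i<m. w i - a * v C i = (\<Sum>D\<in>J. \<mu> D * v D i)"
      using reduced by blast
    have "w i = (\<Sum>D\<in>insert C J. (\<mu>(C := a)) D * v D i)" if "i < m" for i
    proof -
      have "(\<Sum>D\<in>J. (\<mu>(C := a)) D * v D i) = (\<Sum>D\<in>J. \<mu> D * v D i)"
        using insert.hyps by (intro sum.cong) auto
      then show ?thesis using \<mu> that insert.hyps by (simp add: algebra_simps)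
    qed
    then show ?thesis by blast
  qed
  from insert.IH[of "v C"] show ?case
  proof
    assume C: "?span J (v C)"
    from insert.IH[of w] show ?thesis
    proof
      assume "?span J w"
      then show ?thesis using extend[of w 0] by simp
    next
      assume "\<exists>f. (\<Sum>i<m. f i * w i) \<noteq> 0 \<and> (\<forall>D\<in>J. (\<Sum>i<m. f i * v D i) = 0)"
      then obtain f where f: "(\<Sum>i<m. f i * w i) \<noteq> 0" "\<And>D. D \<in> J \<Longrightarrow> (\<Sum>i<m. f i * v D i) = 0" by blast
      obtain \<mu> where \<mu>: "\<forall>i<m. v C i = (\<Sum>D\<in>J. \<mu> D * v D i)" using C by blast
      have "(\<Sum>i<m. f i * v C i) = (\<Sum>i<m. \<Sum>D\<in>J. \<mu> D * (f i * v D i))"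
        using \<mu> by (intro sum.cong refl) (simp add: sum_distrib_left mult_ac)
      also have "\<dots> = (\<Sum>D\<in>J. \<mu> D * (\<Sum>i<m. f i * v D i))"
        by (subst sum.swap) (simp add: sum_distrib_left)
      also have "\<dots> = 0" using f(2) by simp
      finally show ?thesis using f by (intro disjI2 exI[of _ f]) auto
    qed
  next
    assume "\<exists>g. (\<Sum>i<m. g i * v C i) \<noteq> 0 \<and> (\<forall>D\<in>J. (\<Sum>i<m. g i * v D i) = 0)"
    then obtain g where g: "(\<Sum>i<m. g i * v C i) \<noteq> 0" "\<And>D. D \<in> J \<Longrightarrow> (\<Sum>i<m. g i * v D i) = 0" by blast
    define gC where "gC = (\<Sum>i<m. g i * v C i)"
    define a where "a = (\<Sum>i<m. g i * w i) / gC"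
    from insert.IH[of "\<lambda>i. w i - a * v C i"] show ?thesis
    proof
      assume "?span J (\<lambda>i. w i - a * v C i)"
      then show ?thesis using extend by blast
    next
      assume "\<exists>f. (\<Sum>i<m. f i * (w i - a * v C i)) \<noteq> 0 \<and> (\<forall>D\<in>J. (\<Sum>i<m. f i * v D i) = 0)"
      then obtain f where f: "(\<Sum>i<m. f i * (w i - a * v C i)) \<noteq> 0"
        "\<And>D. D \<in> J \<Longrightarrow> (\<Sum>i<m. f i * v D i) = 0" by blast
      \<comment> \<open>By the choice of \<open>a\<close>, \<open>g\<close> vanishes on
        \<open>w - a * v C\<close>; by the choice of \<open>b\<close>, \<open>f - b * g\<close>
        vanishes on \<open>v C\<close>. Hence \<open>f - b * g\<close> takes at \<open>w\<close> the
        same nonzero value as \<open>f\<close> at \<open>w - a * v C\<close>.\<close>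
      define b where "b = (\<Sum>i<m. f i * v C i) / gC"
      have lin: "(\<Sum>i<m. (f i - b * g i) * u i) = (\<Sum>i<m. f i * u i) - b * (\<Sum>i<m. g i * u i)" for u
        by (simp add: algebra_simps sum_subtractf sum_distrib_left)
      have "gC \<noteq> 0" using g by (simp add: gC_def)
      have "(\<Sum>i<m. f i * (w i - a * v C i)) = (\<Sum>i<m. f i * w i) - a * (\<Sum>i<m. f i * v C i)"
        by (simp add: algebra_simps sum_subtractf sum_distrib_left)
      also have "a * (\<Sum>i<m. f i * v C i) = b * (\<Sum>i<m. g i * w i)"
        by (simp add: a_def b_def)
      finally have "(\<Sum>i<m. f i * (w i - a * v C i)) = (\<Sum>i<m. (f i - b * g i) * w i)"
        unfolding lin .
      moreover have "(\<Sum>i<m. (f i - b * g i) * v C i) = 0"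
        unfolding lin using \<open>gC \<noteq> 0\<close> by (simp add: b_def gC_def[symmetric])
      moreover have "(\<Sum>i<m. (f i - b * g i) * v D i) = 0" if "D \<in> J" for D
        unfolding lin using f(2)[OF that] g(2)[OF that] by simp
      ultimately show ?thesis using f(1) by (intro disjI2 exI[of _ "\<lambda>i. f i - b * g i"]) auto
    qed
  qed
qed

text \<open>The sets \<open>M C\<close> are treated one after another, and every point already
  chosen joins the forbidden set \<open>U\<close>. As \<open>N\<close> bounds the number of all
  points involved, robustness applies at each stage.\<close>

lemma glue_robust_representations:
  fixes c :: "'b \<Rightarrow> 'a::field"
  assumes "finite Q" "\<And>C. C \<in> Q \<Longrightarrow> finite (M C)" "disjoint_family_on M Q" "finite U"
    and "(\<Sum>C\<in>Q. card (M C)) + card U \<le> N" "\<And>C. C \<in> Q \<Longrightarrow> robust N (M C) c S (x C)"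
  shows "\<exists>w. w ` (\<Union>C\<in>Q. M C) \<subseteq> S - U \<and> inj_on w (\<Union>C\<in>Q. M C) \<and>
    (\<forall>C\<in>Q. \<forall>t. (\<Sum>j\<in>M C. c j * w j t) = sum c (M C) * x C t)"
  using assms
proof (induction Q)
  case empty
  show ?case by simp
next
  case (insert E Q)
  let ?V = "\<Union>C\<in>Q. M C"
  have "\<exists>w. w ` ?V \<subseteq> S - U \<and> inj_on w ?V \<and>
    (\<forall>C\<in>Q. \<forall>t. (\<Sum>j\<in>M C. c j * w j t) = sum c (M C) * x C t)"
    using insert.prems insert.hyps by (intro insert.IH) (auto simp: disjoint_family_on_def)
  then obtain w where w: "w ` ?V \<subseteq> S - U" "inj_on w ?V"
    "\<And>C t. C \<in> Q \<Longrightarrow> (\<Sum>j\<in>M C. c j * w j t) = sum c (M C) * x C t" by blast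
  have finV: "finite ?V" using insert.prems insert.hyps by auto
  have "card (U \<union> w ` ?V) \<le> card U + card ?V"
    using card_Un_le[of U "w ` ?V"] card_image_le[OF finV, of w] by linarith
  also have "card ?V \<le> (\<Sum>C\<in>Q. card (M C))" using insert.hyps by (intro card_UN_le)
  finally have "card (U \<union> w ` ?V) \<le> N" using insert.prems insert.hyps by simp
  moreover have "finite (U \<union> w ` ?V)" using insert.prems(3) finV by simp
  moreover have "robust N (M E) c S (x E)" using insert.prems(5) by simp
  ultimately have "represents (M E) c (S - (U \<union> w ` ?V)) (\<lambda>t. sum c (M E) * x E t)"
    unfolding robust_def by blast
  then obtain y where y: "y ` M E \<subseteq> S - (U \<union> w ` ?V)" "inj_on y (M E)"
    "\<And>t. (\<Sum>j\<in>M E. c j * y j t) = sum c (M E) * x E t" unfolding represents_def by blast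
  define z where "z j = (if j \<in> M E then y j else w j)" for j
  have disj: "j \<notin> M E" if "j \<in> M C" "C \<in> Q" for j C
    using that insert.prems(2) insert.hyps by (auto simp: disjoint_family_on_def)
  have zE: "z j = y j" if "j \<in> M E" for j using that by (simp add: z_def)
  have zQ: "z j = w j" if "j \<in> ?V" for j using that disj by (auto simp: z_def)
  have "inj_on z (M E)" using y(2) zE by (simp add: inj_on_def)
  moreover have "inj_on z ?V" using w(2) by (simp only: inj_on_def zQ cong: ball_cong)
  moreover have im: "z ` M E = y ` M E" "z ` ?V = w ` ?V"
    using zE zQ by (auto intro!: image_cong)
  moreover have "z ` M E \<inter> z ` ?V = {}" unfolding im using y(1) by blast
  ultimately have "inj_on z (M E \<union> ?V)" by (intro inj_on_Un_disjoint_images)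
  moreover have "z ` (M E \<union> ?V) \<subseteq> S - U" unfolding image_Un im using y(1) w(1) by blast
  moreover have "(\<Sum>j\<in>M C. c j * z j t) = sum c (M C) * x C t" if "C \<in> insert E Q" for C t
  proof (cases "C = E")
    case True
    then show ?thesis using y(3) zE by (metis (mono_tags, lifting) sum.cong)
  next
    case False
    then have "C \<in> Q" using that by simp
    then have "z j = w j" if "j \<in> M C" for j using zQ that by blast
    then have "(\<Sum>j\<in>M C. c j * z j t) = (\<Sum>j\<in>M C. c j * w j t)"
      by (intro sum.cong) simp_all
    then show ?thesis using w(3)[OF \<open>C \<in> Q\<close>] by simp
  qed
  ultimately show ?case by (intro exI[of _ z]) auto
qed

text \<open>A union bound over \<open>Q\<close>: for each \<open>C\<close> the nonrobust points are
  at most the fraction \<open>1 / (2 * card Q)\<close> of \<open>S\<close>, hence altogether at most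
  half. \<open>M C\<close> need not be \<open>C\<close> itself, since one application removes an
  index from each class.\<close>

lemma many_robust_points:
  fixes c :: "nat \<Rightarrow> 'a::{field,finite}"
  assumes "finite Q" "\<And>C. C \<in> Q \<Longrightarrow> finite (M C) \<and> card (M C) \<ge> 2"
    "\<And>C j. C \<in> Q \<Longrightarrow> j \<in> M C \<Longrightarrow> c j \<noteq> 0" "\<And>C. C \<in> Q \<Longrightarrow> card (M C) = 2 \<Longrightarrow> sum c (M C) \<noteq> 0"
  shows "unavoidable (\<lambda>n S. card S \<le> 2 * card {x \<in> S. \<forall>C\<in>Q. robust N (M C) c S x})"
proof -
  have "unavoidable (\<lambda>n S. \<forall>C\<in>Q. (2 * card Q) * card {x \<in> S. \<not> robust N (M C) c S x} \<le> card S)"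
    using assms by (intro unavoidable_ball few_nonrobust_points_class) auto
  then show ?thesis
  proof (rule unavoidable_mono)
    fix n :: nat and S :: "(nat \<Rightarrow> 'a) set"
    assume S: "S \<subseteq> vecs n"
      and H: "\<forall>C\<in>Q. (2 * card Q) * card {x \<in> S. \<not> robust N (M C) c S x} \<le> card S"
    define G where "G = {x \<in> S. \<forall>C\<in>Q. robust N (M C) c S x}"
    have finS: "finite S" using S by (rule finite_subset_vecs)
    have bad: "2 * card (S - G) \<le> card S"
    proof (cases "Q = {}")
      case True
      then show ?thesis by (simp add: G_def)
    next
      case False
      have "S - G \<subseteq> (\<Union>C\<in>Q. {x \<in> S. \<not> robust N (M C) c S x})" by (auto simp: G_def)
      then have "card (S - G) \<le> card (\<Union>C\<in>Q. {x \<in> S. \<not> robust N (M C) c S x})"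
        using finS assms(1) by (intro card_mono) auto
      also have "\<dots> \<le> (\<Sum>C\<in>Q. card {x \<in> S. \<not> robust N (M C) c S x})"
        using assms(1) by (rule card_UN_le)
      finally have "(2 * card Q) * card (S - G) \<le> (2 * card Q) * (\<Sum>C\<in>Q. card {x \<in> S. \<not> robust N (M C) c S x})"
        by (rule mult_le_mono2)
      also have "\<dots> = (\<Sum>C\<in>Q. (2 * card Q) * card {x \<in> S. \<not> robust N (M C) c S x})"
        by (rule sum_distrib_left)
      also have "\<dots> \<le> (\<Sum>C\<in>Q. card S)" using H by (intro sum_mono) auto
      finally have "card Q * (2 * card (S - G)) \<le> card Q * card S" by (simp add: mult_ac)
      moreover have "card Q > 0" using False assms(1) by (simp add: card_gt_0_iff)
      ultimately show ?thesis by simp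
    qed
    have "card S = card G + card (S - G)"
      using finS card_Diff_subset[of G S] card_mono[of S G] by (auto simp: G_def)
    with bad show "card S \<le> 2 * card {x \<in> S. \<forall>C\<in>Q. robust N (M C) c S x}"
      unfolding G_def[symmetric] by linarith
  qed
qed

text \<open>\<open>r C\<close> is a chosen index of the class \<open>C\<close>, and \<open>c j\<close> is the ratio of column \<open>j\<close> to
  the column of the chosen index of its class.\<close>

definition column_classes ::
  "nat \<Rightarrow> nat \<Rightarrow> (nat \<Rightarrow> nat \<Rightarrow> 'a::field) \<Rightarrow> nat set set \<Rightarrow> (nat set \<Rightarrow> nat) \<Rightarrow> (nat \<Rightarrow> 'a) \<Rightarrow> bool" where
  "column_classes m k A P r c \<longleftrightarrow> partition_on {..<k} P \<and>
     (\<forall>C\<in>P. r C \<in> C \<and> c (r C) = 1 \<and> (\<exists>i<m. A i (r C) \<noteq> 0)) \<and> (\<forall>j<k. c j \<noteq> 0) \<and>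
     (\<forall>C\<in>P. \<forall>j\<in>C. \<forall>i<m. A i j = c j * A i (r C))"

section \<open>Systems with a fixed choice of representatives and ratios\<close>

context
  fixes m k :: nat and A :: "nat \<Rightarrow> nat \<Rightarrow> 'a::{field,finite}"
    and P :: "nat set set" and r :: "nat set \<Rightarrow> nat" and c :: "nat \<Rightarrow> 'a"
  assumes classes: "column_classes m k A P r c"
begin

lemma class_partition: "partition_on {..<k} P"
  using classes by (simp add: column_classes_def)

lemma rep_in_class: "C \<in> P \<Longrightarrow> r C \<in> C"
  using classes by (simp add: column_classes_def)

lemma ratio_rep: "C \<in> P \<Longrightarrow> c (r C) = 1"
  using classes by (simp add: column_classes_def)

lemma ratio_nonzero: "j < k \<Longrightarrow> c j \<noteq> 0"
  using classes by (simp add: column_classes_def)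

lemma column_eq: "\<lbrakk>C \<in> P; j \<in> C; i < m\<rbrakk> \<Longrightarrow> A i j = c j * A i (r C)"
  using classes unfolding column_classes_def by blast

lemma column_nonzero: "C \<in> P \<Longrightarrow> \<exists>i<m. A i (r C) \<noteq> 0"
  using classes unfolding column_classes_def by blast

lemma finite_classes: "finite P"
  using finite_elements[OF _ class_partition] by simp

lemma class_subset: "C \<in> P \<Longrightarrow> C \<subseteq> {..<k}"
  using class_partition by (auto simp: partition_on_def)

lemma finite_class: "C \<in> P \<Longrightarrow> finite C"
  using class_subset finite_subset by blast

lemma class_unique: "\<lbrakk>C \<in> P; D \<in> P; j \<in> C; j \<in> D\<rbrakk> \<Longrightarrow> C = D"
  using class_partition by (auto simp: partition_on_def disjoint_def)

lemma in_class: "j < k \<Longrightarrow> \<exists>C\<in>P. j \<in> C"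
  using class_partition by (auto simp: partition_on_def)

lemma card_classes: "(\<Sum>C\<in>P. card C) = k"
proof -
  have "card (\<Union>P) = (\<Sum>C\<in>P. card C)"
    using class_partition finite_class by (intro card_Union_disjoint) (auto simp: partition_on_def)
  then show ?thesis using class_partition by (simp add: partition_on_def)
qed

lemma sum_by_classes:
  assumes "i < m"
  shows "(\<Sum>j<k. A i j * w j) = (\<Sum>C\<in>P. A i (r C) * (\<Sum>j\<in>C. c j * w j))"
proof -
  have "(\<Sum>j<k. A i j * w j) = (\<Sum>j\<in>\<Union>P. A i j * w j)"
    using class_partition by (simp add: partition_on_def)
  also have "\<dots> = (\<Sum>C\<in>P. \<Sum>j\<in>C. A i j * w j)"
    using class_partition finite_class
    by (subst sum.Union_disjoint) (auto simp: partition_on_def disjoint_def)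
  also have "\<dots> = (\<Sum>C\<in>P. A i (r C) * (\<Sum>j\<in>C. c j * w j))"
  proof (rule sum.cong[OF refl])
    fix C assume "C \<in> P"
    then have "A i j * w j = A i (r C) * (c j * w j)" if "j \<in> C" for j
      using column_eq[of C j i] that assms by (simp add: mult_ac)
    then show "(\<Sum>j\<in>C. A i j * w j) = A i (r C) * (\<Sum>j\<in>C. c j * w j)"
      unfolding sum_distrib_left by (rule sum.cong[OF refl])
  qed
  finally show ?thesis .
qed

lemma class_sums_zero_iff:
  assumes "C \<in> P"
  shows "class_sums_zero m A C \<longleftrightarrow> sum c C = 0"
proof -
  have "(\<Sum>j\<in>C. A i j) = sum c C * A i (r C)" if "i < m" for i
    unfolding sum_distrib_right using column_eq[OF assms _ that] by (intro sum.cong) auto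
  then show ?thesis using column_nonzero[OF assms] by (auto simp: class_sums_zero_def)
qed

lemma moderateI:
  assumes "unavoidable (\<lambda>n S. \<exists>w. w ` {..<k} \<subseteq> S \<and> inj_on w {..<k} \<and>
    (\<forall>i<m. \<forall>t. (\<Sum>j<k. A i j * w j t) = 0))"
  shows "moderate m k A"
proof -
  have "unavoidable (\<lambda>n S. \<exists>xs. is_shape m k A n xs \<and> (\<forall>j<k. xs j \<in> S))"
  proof (rule unavoidable_mono[OF assms])
    fix n :: nat and S :: "(nat \<Rightarrow> 'a) set"
    assume S: "S \<subseteq> vecs n" and "\<exists>w. w ` {..<k} \<subseteq> S \<and> inj_on w {..<k} \<and>
      (\<forall>i<m. \<forall>t. (\<Sum>j<k. A i j * w j t) = 0)"
    then obtain w where w: "w ` {..<k} \<subseteq> S" "inj_on w {..<k}" "\<forall>i<m. \<forall>t. (\<Sum>j<k. A i j * w j t) = 0"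
      by blast
    have "\<forall>j<k. w j \<in> S" using w(1) by auto
    moreover have "is_shape m k A n w"
      unfolding is_shape_def is_solution_def using w S by (auto simp: inj_on_def)
    ultimately show "\<exists>xs. is_shape m k A n xs \<and> (\<forall>j<k. xs j \<in> S)" by blast
  qed
  then show ?thesis unfolding unavoidable_def moderate_def .
qed

text \<open>A robust point \<open>x\<close> gives the constant solution \<open>(x, \<dots>, x)\<close>. The contribution of each class of
  size at least 2 is then represented anew by distinct points.\<close>

lemma moderate_if_no_pair_sums_zero:
  assumes balanced: "balanced m k A" and singletons: "card {C \<in> P. card C = 1} \<le> 1"
    and pairs: "\<And>C. C \<in> P \<Longrightarrow> card C = 2 \<Longrightarrow> sum c C \<noteq> 0"
  shows "moderate m k A"
proof (rule moderateI)
  note [simp] = finite_classes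
  define Q where "Q = {C \<in> P. card C \<ge> 2}"
  \<comment> \<open>The bound \<open>k + 1\<close> covers the points of all classes and the point
    \<open>x\<close> itself, which stays in use on a class of size 1.\<close>
  have "unavoidable (\<lambda>n S. card S \<le> 2 * card {x \<in> S. \<forall>C\<in>Q. robust (k + 1) C c S x})"
    using finite_class class_subset ratio_nonzero pairs by (intro many_robust_points) (auto simp: Q_def)
  from unavoidable_conj[OF this unavoidable_card_ge[of 1]]
  show "unavoidable (\<lambda>n S. \<exists>w. w ` {..<k} \<subseteq> S \<and> inj_on w {..<k} \<and>
    (\<forall>i<m. \<forall>t. (\<Sum>j<k. A i j * w j t) = 0))"
  proof (rule unavoidable_mono)
    fix n :: nat and S :: "(nat \<Rightarrow> 'a) set"
    assume "card S \<le> 2 * card {x \<in> S. \<forall>C\<in>Q. robust (k + 1) C c S x} \<and> 1 \<le> card S"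
    then have "card {x \<in> S. \<forall>C\<in>Q. robust (k + 1) C c S x} > 0" by linarith
    then have "{x \<in> S. \<forall>C\<in>Q. robust (k + 1) C c S x} \<noteq> {}" by (metis card.empty less_irrefl)
    then obtain x where x: "x \<in> S" "\<And>C. C \<in> Q \<Longrightarrow> robust (k + 1) C c S x" by blast
    have "(\<Sum>C\<in>Q. card C) \<le> (\<Sum>C\<in>P. card C)" by (intro sum_mono2) (auto simp: Q_def)
    then have cards: "(\<Sum>C\<in>Q. card C) + card {x} \<le> k + 1" by (simp add: card_classes)
    have disj: "disjoint_family_on (\<lambda>C. C) Q"
      using class_unique by (auto simp: disjoint_family_on_def Q_def)
    have "\<exists>w. w ` (\<Union>C\<in>Q. C) \<subseteq> S - {x} \<and> inj_on w (\<Union>C\<in>Q. C) \<and>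
      (\<forall>C\<in>Q. \<forall>t. (\<Sum>j\<in>C. c j * w j t) = sum c C * x t)"
      using finite_class by (intro glue_robust_representations[OF _ _ disj _ cards x(2)]) (auto simp: Q_def)
    then obtain w where w: "w ` \<Union>Q \<subseteq> S - {x}" "inj_on w (\<Union>Q)"
      "\<And>C t. C \<in> Q \<Longrightarrow> (\<Sum>j\<in>C. c j * w j t) = sum c C * x t"
      unfolding image_ident by blast
    \<comment> \<open>The default value \<open>x\<close> is taken only at indices in classes of size
      1. There is at most one of these, so no value is repeated.\<close>
    define z where "z j = (if j \<in> \<Union>Q then w j else x)" for j
    have single: "\<exists>C\<in>P. card C = 1 \<and> C = {j}" if "j < k" "j \<notin> \<Union>Q" for j
    proof -
      obtain C where C: "C \<in> P" "j \<in> C" using in_class \<open>j < k\<close> by blast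
      then have "card C \<noteq> 0" using finite_class by auto
      moreover have "card C < 2" using C that by (auto simp: Q_def not_le[symmetric])
      ultimately have "card C = 1" by linarith
      then show ?thesis using C by (metis card_1_singletonE singletonD)
    qed
    have zQ: "(\<Sum>j\<in>C. c j * z j t) = sum c C * x t" if "C \<in> P" for C t
    proof (cases "C \<in> Q")
      case True
      then have "(\<Sum>j\<in>C. c j * z j t) = (\<Sum>j\<in>C. c j * w j t)"
        by (intro sum.cong) (auto simp: z_def)
      then show ?thesis using w(3)[OF True] by simp
    next
      case False
      have "z j = x" if "j \<in> C" for j
      proof -
        have "D = C" if "D \<in> Q" "j \<in> D" for D
          using class_unique[OF \<open>C \<in> P\<close> _ \<open>j \<in> C\<close> that(2)] that(1) by (simp add: Q_def)
        then have "j \<notin> \<Union>Q" using False by blast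
        then show ?thesis by (simp add: z_def)
      qed
      then show ?thesis by (simp add: sum_distrib_right)
    qed
    have "z ` {..<k} \<subseteq> S" using x w(1) by (auto simp: z_def)
    moreover have "inj_on z {..<k}"
    proof (rule inj_onI)
      fix j j' assume j: "j \<in> {..<k}" "j' \<in> {..<k}" "z j = z j'"
      have out: "z h = x \<longleftrightarrow> h \<notin> \<Union>Q" for h using w(1) by (auto simp: z_def)
      show "j = j'"
      proof (cases "j \<in> \<Union>Q")
        case True
        then have "j' \<in> \<Union>Q" using out j(3) by metis
        then show ?thesis using True j(3) w(2) by (auto simp: z_def dest: inj_onD)
      next
        case False
        then have "j' \<notin> \<Union>Q" using out j(3) by metis
        then have "{j} \<in> {C \<in> P. card C = 1}" "{j'} \<in> {C \<in> P. card C = 1}"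
          using single[of j] single[of j'] False j by auto
        moreover have "\<forall>D\<in>{C \<in> P. card C = 1}. \<forall>D'\<in>{C \<in> P. card C = 1}. D = D'"
          using singletons by (subst card_le_Suc0_iff_eq[symmetric]) auto
        ultimately have "{j} = {j'}" by blast
        then show ?thesis by simp
      qed
    qed
    moreover have "(\<Sum>j<k. A i j * z j t) = 0" if i: "i < m" for i t
    proof -
      have "(\<Sum>j<k. A i j * z j t) = (\<Sum>C\<in>P. A i (r C) * (sum c C * x t))"
        by (simp add: sum_by_classes[OF i] zQ)
      also have "\<dots> = (\<Sum>j<k. A i j * x t)"
        by (simp add: sum_by_classes[OF i] sum_distrib_right)
      also have "\<dots> = 0" using balanced i by (simp add: balanced_def sum_distrib_right[symmetric])
      finally show ?thesis .
    qed
    ultimately show "\<exists>w. w ` {..<k} \<subseteq> S \<and> inj_on w {..<k} \<and>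
      (\<forall>i<m. \<forall>t. (\<Sum>j<k. A i j * w j t) = 0)" by blast
  qed
qed

text \<open>A class outside the span of the other classes splits off.\<close>

lemma class_in_span_of_others:
  assumes "irreducible_sys m k A" "card P \<ge> 2" and C: "C \<in> P"
  shows "\<exists>\<mu>. \<mu> C = 1 \<and> (\<forall>i<m. (\<Sum>D\<in>P. \<mu> D * A i (r D)) = 0)"
proof -
  note [simp] = finite_classes
  have "finite (P - {C})" by simp
  from fredholm_alternative[OF this, of m "\<lambda>i. A i (r C)" "\<lambda>D i. A i (r D)"]
  show ?thesis
  proof
    assume "\<exists>\<mu>. \<forall>i<m. A i (r C) = (\<Sum>D\<in>P - {C}. \<mu> D * A i (r D))"
    then obtain \<mu> where \<mu>: "\<And>i. i < m \<Longrightarrow> A i (r C) = (\<Sum>D\<in>P - {C}. \<mu> D * A i (r D))" by blast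
    define \<nu> where "\<nu> D = (if D = C then 1 else - \<mu> D)" for D
    have "(\<Sum>D\<in>P. \<nu> D * A i (r D)) = 0" if "i < m" for i
    proof -
      have "(\<Sum>D\<in>P. \<nu> D * A i (r D)) = A i (r C) + (\<Sum>D\<in>P - {C}. \<nu> D * A i (r D))"
        using C by (subst sum.remove[of P C]) (auto simp: \<nu>_def)
      also have "(\<Sum>D\<in>P - {C}. \<nu> D * A i (r D)) = - (\<Sum>D\<in>P - {C}. \<mu> D * A i (r D))"
        by (simp add: \<nu>_def sum_negf[symmetric])
      finally show ?thesis using \<mu>[OF that] by simp
    qed
    then show ?thesis by (intro exI[of _ \<nu>]) (simp add: \<nu>_def)
  next
    assume "\<exists>f. (\<Sum>i<m. f i * A i (r C)) \<noteq> 0 \<and> (\<forall>D\<in>P - {C}. (\<Sum>i<m. f i * A i (r D)) = 0)"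
    then obtain f where f: "(\<Sum>i<m. f i * A i (r C)) \<noteq> 0"
      "\<And>D. D \<in> P \<Longrightarrow> D \<noteq> C \<Longrightarrow> (\<Sum>i<m. f i * A i (r D)) = 0" by blast
    define s where "s = (\<Sum>i<m. f i * A i (r C))"
    define F where "F j = (\<Sum>i<m. f i * A i j)" for j
    have F: "F j = c j * (\<Sum>i<m. f i * A i (r D))" if "D \<in> P" "j \<in> D" for j D
      unfolding F_def sum_distrib_left using column_eq[OF that] by (intro sum.cong) (auto simp: mult_ac)
    \<comment> \<open>The combination \<open>F\<close> of the rows is supported on \<open>C\<close>,
      where it is \<open>s\<close> times the ratio \<open>c\<close>. Adding it as row
      \<open>m\<close> and subtracting the right multiple from each old row clears the columns of
      \<open>C\<close> there, so every row of \<open>B\<close> lives on \<open>C\<close> or on its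
      complement.\<close>
    define B where "B i j = (if i = m then F j else A i j - A i (r C) / s * F j)" for i j
    have "rows_combination k m A (Suc m) B"
      unfolding rows_combination_def
    proof (intro allI impI)
      fix i assume i: "i < Suc m"
      show "\<exists>d. \<forall>j<k. B i j = (\<Sum>h<m. d h * A h j)"
      proof (cases "i = m")
        case True
        then show ?thesis by (intro exI[of _ f]) (simp add: B_def F_def)
      next
        case False
        then have "i < m" using i by simp
        have "(\<Sum>h<m. ((if h = i then 1 else 0) - A i (r C) / s * f h) * A h j) = B i j" for j
        proof -
          have "(\<Sum>h<m. ((if h = i then 1 else 0) - A i (r C) / s * f h) * A h j)
            = (\<Sum>h<m. if h = i then A h j else 0) - A i (r C) / s * F j"
            unfolding F_def sum_distrib_left sum_subtractf[symmetric]
            by (intro sum.cong) (auto simp: algebra_simps)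
          then show ?thesis using \<open>i < m\<close> False by (simp add: B_def)
        qed
        then show ?thesis by (intro exI[of _ "\<lambda>h. (if h = i then 1 else 0) - A i (r C) / s * f h"]) simp
      qed
    qed
    moreover have "rows_combination k (Suc m) B m A"
      unfolding rows_combination_def
    proof (intro allI impI)
      fix i assume i: "i < m"
      have "(\<Sum>h<m. (if h = i then 1 else 0) * B h j) = (\<Sum>h<m. if h = i then B h j else 0)" for j
        by (intro sum.cong) auto
      then show "\<exists>d. \<forall>j<k. A i j = (\<Sum>h<Suc m. d h * B h j)"
        using i by (intro exI[of _ "\<lambda>h. if h = m then A i (r C) / s else if h = i then 1 else 0"])
          (simp add: B_def)
    qed
    moreover have "partition_on {..<k} {C, {..<k} - C}" "card {C, {..<k} - C} = 2"
    proof -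
      have "C \<noteq> {}" using rep_in_class[OF C] by auto
      have "\<not> P \<subseteq> {C}" using assms(2) card_mono[of "{C}" P] by auto
      then obtain D where D: "D \<in> P" "D \<noteq> C" by blast
      then have "r D \<in> {..<k} - C" using rep_in_class class_subset class_unique C by blast
      then have "{..<k} - C \<noteq> {}" by blast
      then show "partition_on {..<k} {C, {..<k} - C}" "card {C, {..<k} - C} = 2"
        using \<open>C \<noteq> {}\<close> class_subset[OF C] by (auto simp: partition_on_def disjoint_def card_insert_if)
    qed
    moreover have "\<exists>D\<in>{C, {..<k} - C}. \<forall>j<k. B i j \<noteq> 0 \<longrightarrow> j \<in> D" if i: "i < Suc m" for i
    proof (cases "i = m")
      case True
      have "B i j = 0" if "j < k" "j \<notin> C" for j
      proof -
        obtain D where "D \<in> P" "j \<in> D" using in_class \<open>j < k\<close> by blast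
        then show ?thesis using True that F[of D j] f(2)[of D] by (auto simp: B_def)
      qed
      then show ?thesis by auto
    next
      case False
      have "B i j = 0" if "j \<in> C" for j
        using False i f(1) F[OF C that] column_eq[OF C that, of i] by (simp add: B_def s_def)
      then show ?thesis by auto
    qed
    ultimately have "reducible m k A"
      unfolding reducible_def systems_equiv_def
      by (intro exI[of _ "Suc m"] exI[of _ B] exI[of _ "{C, {..<k} - C}"]) auto
    then show ?thesis using assms(1) by (simp add: irreducible_sys_def)
  qed
qed

text \<open>A class \<open>C\<close> contributes the difference \<open>x C - x' C\<close>, where \<open>x C\<close> takes the index \<open>r C\<close> and
  \<open>- x' C\<close> is represented on the rest of the class.\<close>

lemma moderate_if_all_classes_sum_zero:
  assumes irr: "irreducible_sys m k A" and card2: "card P \<ge> 2"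
    and zero: "\<And>C. C \<in> P \<Longrightarrow> sum c C = 0"
  shows "moderate m k A"
proof (rule moderateI)
  note [simp] = finite_classes
  define M where "M C = C - {r C}" for C
  \<comment> \<open>In a class of size 2 the index other than \<open>r C\<close> has coefficient
    \<open>- 1\<close>, so it can take the value \<open>x' C\<close> directly; only larger classes
    need a representation.\<close>
  define Q where "Q = {C \<in> P. card C \<ge> 3}"
  have finM: "finite (M C)" and cardM: "card (M C) = card C - 1" and sumM: "sum c (M C) = - 1"
    if "C \<in> P" for C
  proof -
    show "finite (M C)" "card (M C) = card C - 1" using that finite_class rep_in_class by (auto simp: M_def)
    have "sum c C = 1 + sum c (M C)"
      using that finite_class rep_in_class by (simp add: M_def sum.remove[of C "r C"] ratio_rep)
    then show "sum c (M C) = - 1" using zero[OF that] by (simp add: add_eq_0_iff)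
  qed
  have card_class: "card C \<ge> 2" if "C \<in> P" for C
  proof (rule ccontr)
    assume "\<not> ?thesis"
    then have "card (M C) = 0" using cardM[OF that] by simp
    then have "M C = {}" using finM[OF that] by simp
    then show False using sumM[OF that] by simp
  qed
  \<comment> \<open>At most \<open>k\<close> points for the classes in \<open>Q\<close> and at most
    \<open>2 * k\<close> for the pairs \<open>x C\<close>, \<open>x' C\<close>.\<close>
  define N where "N = 3 * k"
  have "unavoidable (\<lambda>n S. card S \<le> 2 * card {x \<in> S. \<forall>C\<in>Q. robust N (M C) c S x})"
  proof (rule many_robust_points)
    show "c j \<noteq> 0" if "C \<in> Q" "j \<in> M C" for C j
      using that class_subset ratio_nonzero by (auto simp: Q_def M_def)
  qed (use finM cardM sumM in \<open>auto simp: Q_def\<close>)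
  moreover have "unavoidable (\<lambda>n S. \<exists>x x'. separated_pairs P S x x' \<and>
    (\<forall>i<m. \<forall>t. (\<Sum>C\<in>P. A i (r C) * (x C t - x' C t)) = 0))"
    using card2 class_in_span_of_others[OF irr card2] by (intro difference_system_unavoidable) auto
  ultimately show "unavoidable (\<lambda>n S. \<exists>w. w ` {..<k} \<subseteq> S \<and> inj_on w {..<k} \<and>
    (\<forall>i<m. \<forall>t. (\<Sum>j<k. A i j * w j t) = 0))"
  proof (rule unavoidable_mono[OF unavoidable_conj[OF _ unavoidable_dense_subset[of _ 2]]])
    fix n :: nat and S :: "(nat \<Rightarrow> 'a) set"
    define G where "G = {x \<in> S. \<forall>C\<in>Q. robust N (M C) c S x}"
    assume "card S \<le> 2 * card {x \<in> S. \<forall>C\<in>Q. robust N (M C) c S x} \<and>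
      (\<forall>T\<subseteq>S. card S \<le> 2 * card T \<longrightarrow> (\<exists>x x'. separated_pairs P T x x' \<and>
        (\<forall>i<m. \<forall>t. (\<Sum>C\<in>P. A i (r C) * (x C t - x' C t)) = 0)))"
    moreover have "G \<subseteq> S" by (auto simp: G_def)
    ultimately have "\<exists>x x'. separated_pairs P G x x' \<and>
        (\<forall>i<m. \<forall>t. (\<Sum>C\<in>P. A i (r C) * (x C t - x' C t)) = 0)" by (auto simp: G_def)
    then obtain x x' where sep: "separated_pairs P G x x'"
      and sol: "\<And>i t. i < m \<Longrightarrow> (\<Sum>C\<in>P. A i (r C) * (x C t - x' C t)) = 0" by blast
    define U where "U = x ` P \<union> x' ` P"
    have "card P \<le> k"
      using sum_mono[of P "\<lambda>_. 1" card] card_class card_classes by force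
    then have "card U \<le> 2 * k"
      unfolding U_def using card_Un_le[of "x ` P" "x' ` P"] card_image_le[of P x] card_image_le[of P x']
      by simp
    moreover have "(\<Sum>C\<in>Q. card (M C)) \<le> k"
    proof -
      have "(\<Sum>C\<in>Q. card (M C)) \<le> (\<Sum>C\<in>Q. card C)" using cardM by (intro sum_mono) (auto simp: Q_def)
      also have "\<dots> \<le> (\<Sum>C\<in>P. card C)" by (intro sum_mono2) (auto simp: Q_def)
      finally show ?thesis by (simp add: card_classes)
    qed
    ultimately have "(\<Sum>C\<in>Q. card (M C)) + card U \<le> N" by (simp add: N_def)
    moreover have "disjoint_family_on M Q"
      using class_unique by (auto simp: disjoint_family_on_def Q_def M_def)
    moreover have "robust N (M C) c S (x' C)" if "C \<in> Q" for C
      using sep that by (auto simp: separated_pairs_def Q_def G_def image_subset_iff)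
    moreover have "finite Q" "finite U" by (auto simp: Q_def U_def)
    moreover have "finite (M C)" if "C \<in> Q" for C using finM that by (simp add: Q_def)
    ultimately have "\<exists>w. w ` (\<Union>C\<in>Q. M C) \<subseteq> S - U \<and> inj_on w (\<Union>C\<in>Q. M C) \<and>
        (\<forall>C\<in>Q. \<forall>t. (\<Sum>j\<in>M C. c j * w j t) = sum c (M C) * x' C t)"
      by (intro glue_robust_representations[of Q M U N])
    then obtain w where w: "w ` (\<Union>C\<in>Q. M C) \<subseteq> S - U" "inj_on w (\<Union>C\<in>Q. M C)"
      "\<And>C t. C \<in> Q \<Longrightarrow> (\<Sum>j\<in>M C. c j * w j t) = sum c (M C) * x' C t" by blast
    define cl where "cl j = (THE C. C \<in> P \<and> j \<in> C)" for j
    have cl: "cl j = C" if "C \<in> P" "j \<in> C" for j C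
      unfolding cl_def using that class_unique by (intro the_equality) auto
    \<comment> \<open>The indices fall into three groups: chosen indices with values in
      \<open>x\<close> P\<open>, the other indices of pairs with values in\<close>x'
      \<open>P\<close>, and the rest with values of \<open>w\<close> outside \<open>U\<close>. These
      three sets of values are disjoint, so injectivity can be checked within each group.\<close>
    define z where "z j = (if j = r (cl j) then x (cl j) else if card (cl j) = 2 then x' (cl j) else w j)" for j
    have z_rep: "z (r C) = x C" if "C \<in> P" for C using that rep_in_class by (simp add: z_def cl)
    have z_pair: "z j = x' C" if "C \<in> P" "card C = 2" "j \<in> M C" for C j
      using that cl[of C j] by (auto simp: z_def M_def)
    have z_big: "z j = w j" if "C \<in> Q" "j \<in> M C" for C j
      using that cl[of C j] by (auto simp: z_def M_def Q_def)
    define T where "T = {C \<in> P. card C = 2}"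
    have PTQ: "P = T \<union> Q" using card_class by (force simp: T_def Q_def)
    have cover: "{..<k} \<subseteq> r ` P \<union> (\<Union>C\<in>T. M C) \<union> (\<Union>C\<in>Q. M C)"
    proof
      fix j assume "j \<in> {..<k}"
      then obtain C where C: "C \<in> P" "j \<in> C" using in_class by blast
      then have "C \<in> T \<or> C \<in> Q" using PTQ by blast
      then show "j \<in> r ` P \<union> (\<Union>C\<in>T. M C) \<union> (\<Union>C\<in>Q. M C)" using C by (auto simp: M_def)
    qed
    have im1: "z ` r ` P = x ` P" unfolding image_image using z_rep by (rule image_cong[OF refl])
    have im2: "z ` (\<Union>C\<in>T. M C) \<subseteq> x' ` P"
    proof (rule image_subsetI)
      fix j assume "j \<in> (\<Union>C\<in>T. M C)"
      then obtain C where "C \<in> T" "j \<in> M C" by blast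
      then have "z j = x' C" "C \<in> P" using z_pair by (auto simp: T_def)
      then show "z j \<in> x' ` P" by simp
    qed
    have im3: "z ` (\<Union>C\<in>Q. M C) = w ` (\<Union>C\<in>Q. M C)"
    proof (rule image_cong[OF refl])
      fix j assume "j \<in> (\<Union>C\<in>Q. M C)"
      then show "z j = w j" using z_big by blast
    qed
    have "z ` {..<k} \<subseteq> z ` r ` P \<union> z ` (\<Union>C\<in>T. M C) \<union> z ` (\<Union>C\<in>Q. M C)"
      using image_mono[OF cover, of z] by (simp only: image_Un)
    also have "\<dots> \<subseteq> S"
    proof -
      have "x ` P \<subseteq> S" "x' ` P \<subseteq> S" using sep \<open>G \<subseteq> S\<close> by (auto simp: separated_pairs_def)
      then have "z ` r ` P \<subseteq> S" "z ` (\<Union>C\<in>T. M C) \<subseteq> S" using im1 im2 by (simp, meson order_trans)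
      moreover have "z ` (\<Union>C\<in>Q. M C) \<subseteq> S" unfolding im3 using w(1) Diff_subset by (rule order_trans)
      ultimately show ?thesis by (intro Un_least)
    qed
    finally have "z ` {..<k} \<subseteq> S" .
    moreover have "inj_on z {..<k}"
    proof -
      have "inj_on z (r ` P)"
        using sep z_rep by (auto simp: separated_pairs_def inj_on_def)
      moreover have "inj_on z (\<Union>C\<in>T. M C)"
      proof (rule inj_onI)
        fix j j' assume "j \<in> (\<Union>C\<in>T. M C)" "j' \<in> (\<Union>C\<in>T. M C)" and eq: "z j = z j'"
        then obtain C C' where C: "C \<in> T" "j \<in> M C" "C' \<in> T" "j' \<in> M C'" by blast
        then have CP: "C \<in> P" "C' \<in> P" and "z j = x' C" "z j' = x' C'"
          using z_pair[of C j] z_pair[of C' j'] by (simp_all add: T_def)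
        then have "x' C = x' C'" using eq by simp
        moreover have "inj_on x' P" using sep by (simp add: separated_pairs_def)
        ultimately have "C = C'" using CP by (simp add: inj_on_def)
        moreover have "card (M C) = 1" using C cardM by (simp add: T_def)
        ultimately show "j = j'" using C by (metis card_1_singletonE singletonD)
      qed
      moreover have "inj_on z (\<Union>C\<in>Q. M C)"
      proof (rule inj_onI)
        fix j j' assume "j \<in> (\<Union>C\<in>Q. M C)" "j' \<in> (\<Union>C\<in>Q. M C)" and eq: "z j = z j'"
        moreover from this have "z j = w j" "z j' = w j'" using z_big by blast+
        ultimately show "j = j'" using eq by (intro inj_onD[OF w(2)]) simp_all
      qed
      moreover have "x ` P \<inter> x' ` P = {}" using sep by (simp add: separated_pairs_def)
      with im1 im2 have "z ` r ` P \<inter> z ` (\<Union>C\<in>T. M C) = {}" by blast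
      moreover have "z ` (r ` P \<union> (\<Union>C\<in>T. M C)) \<inter> z ` (\<Union>C\<in>Q. M C) = {}"
      proof -
        have "z ` (r ` P \<union> (\<Union>C\<in>T. M C)) \<subseteq> U"
          unfolding image_Un im1 U_def using im2 by (rule Un_mono[OF order_refl])
        moreover have "U \<inter> w ` (\<Union>C\<in>Q. M C) = {}" using w(1) by blast
        ultimately show ?thesis unfolding im3 using Int_mono[OF _ order_refl] by (metis subset_empty)
      qed
      ultimately have "inj_on z (r ` P \<union> (\<Union>C\<in>T. M C) \<union> (\<Union>C\<in>Q. M C))"
        by (intro inj_on_Un_disjoint_images)
      then show ?thesis using cover by (rule inj_on_subset)
    qed
    moreover have "(\<Sum>j<k. A i j * z j t) = 0" if i: "i < m" for i t
    proof -
      have "(\<Sum>j\<in>C. c j * z j t) = x C t - x' C t" if C: "C \<in> P" for C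
      proof -
        have "(\<Sum>j\<in>M C. c j * z j t) = sum c (M C) * x' C t"
        proof (cases "C \<in> Q")
          case True
          then show ?thesis using w(3)[OF True] z_big[OF True] by simp
        next
          case False
          then have "card C = 2" using C card_class[OF C] by (simp add: Q_def)
          then show ?thesis using z_pair[OF C] by (simp add: sum_distrib_right)
        qed
        then have "(\<Sum>j\<in>M C. c j * z j t) = - x' C t" using sumM[OF C] by simp
        then show ?thesis
          using C finite_class rep_in_class z_rep by (simp add: M_def sum.remove[of C "r C"] ratio_rep)
      qed
      then show ?thesis using sol[OF i] by (simp add: sum_by_classes[OF i])
    qed
    ultimately show "\<exists>w. w ` {..<k} \<subseteq> S \<and> inj_on w {..<k} \<and>
      (\<forall>i<m. \<forall>t. (\<Sum>j<k. A i j * w j t) = 0)" by blast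
  qed
qed

end

section \<open>Passing from the column equivalence relation to representatives and ratios\<close>

lemma col_equiv_refl: "col_equiv m A j j"
  unfolding col_equiv_def by (intro exI[of _ 1]) simp

lemma col_equiv_sym: "col_equiv m A j j' \<Longrightarrow> col_equiv m A j' j"
proof -
  assume "col_equiv m A j j'"
  then obtain d where "d \<noteq> 0" "\<forall>i<m. A i j' = d * A i j" unfolding col_equiv_def by blast
  then show ?thesis unfolding col_equiv_def by (intro exI[of _ "inverse d"]) auto
qed

lemma col_equiv_trans: "col_equiv m A j j' \<Longrightarrow> col_equiv m A j' j'' \<Longrightarrow> col_equiv m A j j''"
proof -
  assume "col_equiv m A j j'" "col_equiv m A j' j''"
  then obtain d e where "d \<noteq> 0" "\<forall>i<m. A i j' = d * A i j" "e \<noteq> 0" "\<forall>i<m. A i j'' = e * A i j'"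
    unfolding col_equiv_def by blast
  then show ?thesis unfolding col_equiv_def by (intro exI[of _ "e * d"]) auto
qed

lemma column_classes_col_classes:
  fixes A :: "nat \<Rightarrow> nat \<Rightarrow> 'a::{field,finite}"
  assumes "non_degenerate m k A"
  shows "\<exists>r c. column_classes m k A (col_classes m k A) r c"
proof -
  define cls where "cls j = {j'. j' < k \<and> col_equiv m A j j'}" for j
  have P: "col_classes m k A = cls ` {..<k}" by (simp add: col_classes_def cls_def)
  have self: "j \<in> cls j" if "j < k" for j using that col_equiv_refl by (auto simp: cls_def)
  have eq: "cls j' = cls j" if "j' \<in> cls j" for j j'
    using that col_equiv_sym col_equiv_trans unfolding cls_def by blast
  define r where "r C = (SOME j. j \<in> C)" for C :: "nat set"
  have r: "r (cls j) \<in> cls j" if "j < k" for j unfolding r_def using self[OF that] by (rule someI)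
  \<comment> \<open>The case distinction makes the ratio at a chosen index 1 by definition, without
    a uniqueness argument for ratios.\<close>
  define c where "c j = (if j = r (cls j) then 1
    else SOME d. d \<noteq> 0 \<and> (\<forall>i<m. A i j = d * A i (r (cls j))))" for j
  have c: "c j \<noteq> 0 \<and> (\<forall>i<m. A i j = c j * A i (r (cls j)))" if "j < k" for j
  proof (cases "j = r (cls j)")
    case True
    then have "c j = 1" by (simp add: c_def)
    then show ?thesis using True by simp
  next
    case False
    have "col_equiv m A (r (cls j)) j" using r[OF that] col_equiv_sym by (auto simp: cls_def)
    then have ex: "\<exists>d. d \<noteq> 0 \<and> (\<forall>i<m. A i j = d * A i (r (cls j)))" by (simp add: col_equiv_def)
    have cj: "c j = (SOME d. d \<noteq> 0 \<and> (\<forall>i<m. A i j = d * A i (r (cls j))))"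
      unfolding c_def using False by (rule if_not_P)
    show ?thesis unfolding cj by (rule someI_ex[OF ex])
  qed
  have "partition_on {..<k} (cls ` {..<k})"
    unfolding partition_on_def
  proof (intro conjI)
    show "\<Union> (cls ` {..<k}) = {..<k}" using self by (auto simp: cls_def)
    show "disjoint (cls ` {..<k})" unfolding disjoint_def using eq by blast
    show "{} \<notin> cls ` {..<k}" using self by blast
  qed
  moreover have "r C \<in> C \<and> c (r C) = 1 \<and> (\<exists>i<m. A i (r C) \<noteq> 0)"
    "\<forall>j'\<in>C. \<forall>i<m. A i j' = c j' * A i (r C)" if C: "C \<in> cls ` {..<k}" for C
  proof -
    obtain j where j: "j < k" "C = cls j" using C by auto
    have "r C \<in> C" using r j by simp
    moreover have "r C < k" using r[OF j(1)] j by (simp add: cls_def)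
    moreover have "c (r C) = 1" using eq[OF r[OF j(1)]] j by (simp add: c_def)
    ultimately show "r C \<in> C \<and> c (r C) = 1 \<and> (\<exists>i<m. A i (r C) \<noteq> 0)"
      using assms by (simp add: non_degenerate_def)
    have "A i j' = c j' * A i (r C)" if "j' \<in> C" "i < m" for i j'
      using c[of j'] that eq[of j' j] j by (auto simp: cls_def)
    then show "\<forall>j'\<in>C. \<forall>i<m. A i j' = c j' * A i (r C)" by blast
  qed
  moreover have "\<forall>j<k. c j \<noteq> 0" using c by blast
  ultimately have "column_classes m k A (cls ` {..<k}) r c"
    unfolding column_classes_def by blast
  then show ?thesis using P by auto
qed

theorem theoremA:
  fixes A :: "nat \<Rightarrow> nat \<Rightarrow> 'a::{field,finite}" and m k :: nat
  assumes "type_RC m k A" and "non_degenerate m k A" and "irreducible_sys m k A"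
    and "(\<forall>C\<in>col_classes m k A. card C = 2 \<longrightarrow> \<not> class_sums_zero m A C)
         \<or> ((\<forall>C\<in>col_classes m k A. class_sums_zero m A C) \<and> k \<ge> 3)"
  shows "moderate m k A"
proof -
  let ?P = "col_classes m k A"
  obtain r c where cc: "column_classes m k A ?P r c"
    using column_classes_col_classes[OF assms(2)] by blast
  have RC: "balanced m k A" "card {C \<in> ?P. card C = 1} \<le> 1" using assms(1) by (auto simp: type_RC_def)
  show ?thesis
  \<comment> \<open>The distinction is whether some class of size 2 sums to zero. If so, (i) fails
    and (ii) must hold; the class of size 2 cannot be the only class because
    \<open>k \<ge> 3\<close>, which gives the two classes needed for the difference system.\<close>
  proof (cases "\<forall>C\<in>?P. card C = 2 \<longrightarrow> sum c C \<noteq> 0")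
    case True
    then show ?thesis
      by (intro moderate_if_no_pair_sums_zero[OF cc RC]) auto
  next
    case False
    then have zero: "\<forall>C\<in>?P. sum c C = 0" and "k \<ge> 3"
      using assms(4) class_sums_zero_iff[OF cc] by auto
    obtain C where C: "C \<in> ?P" "card C = 2" using False by blast
    have "card ?P \<noteq> 0" using C finite_classes[OF cc] by auto
    moreover have "card ?P \<noteq> 1"
    proof
      assume "card ?P = 1"
      then have "?P = {C}" using C by (metis card_1_singletonE singletonD)
      then show False using card_classes[OF cc] C \<open>k \<ge> 3\<close> by simp
    qed
    ultimately have "card ?P \<ge> 2" by linarith
    then show ?thesis using zero
      by (intro moderate_if_all_classes_sum_zero[OF cc assms(3)]) auto
  qed
qed

end
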